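(* Suppose $L_i=L$ for all $i\in\mathcal V$ with $L\ge\frac1{4\sqrt2}$. The decentralized sketched primal-dual algorithm SkPD (described in the context) run with step size $\eta_i=\eta=\frac1{8nL}$ for all $i$ incurs a sketched-gradient oracle complexity of $$O\left(\frac{E+V(1+nL)}{\epsilon}\right).$$
   Context: $\mathcal G=(\mathcal V,\mathcal E)$ is a connected undirected graph with $V=|\mathcal V|$ nodes and $E=|\mathcal E|$ edges; $\mathcal N_i$ is the set of neighbors of $i$. For each node $i$, $f_i(\mathbf{x})=\frac1{K_i}\sum_{k=1}^{K_i} f_i(\mathbf{x},\xi_i^k)$ on $\mathbb R^n$ with each $f_i(\cdot,\xi_i^k)$ proper, closed, convex and $L_i$-smooth; each $h_i$ is proper, closed, convex, possibly non-smooth. $\mathbf{x}_i^\star$ ($i\in\mathcal V$) is a solution of $\min\sum_{i\in\mathcal V}(f_i(\mathbf{x}_i)+h_i(\mathbf{x}_i))$ s.t. $\mathbf{x}_i=\mathbf{x}_j$ for all $(i,j)\in\mathcal E$, and $\boldsymbol\lambda_{ij}^\star$ (one for each ordered pair of neighbors), $\mathbf{v}_i^\star\in\partial h_i(\mathbf{x}_i^\star)$ satisfy $\mathbf{x}_i^\star=\mathbf{x}_j^\star$ $(=:\mathbf{x}^\star)$, $\boldsymbol\lambda_{ij}^\star+\boldsymbol\lambda_{ji}^\star=0$, $\mathbf{v}_i^\star+\nabla f_i(\mathbf{x}_i^\star)+\sum_{j\in\mathcal N_i}\boldsymbol\lambda_{ji}^\star=0$. Bregman divergences: $D_{f_i}(\mathbf{x},\mathbf{y})=f_i(\mathbf{x})-f_i(\mathbf{y})-\langle\nabla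 f_i(\mathbf{y}),\mathbf{x}-\mathbf{y}\rangle$; $D_{h_i}(\mathbf{x},\mathbf{x}_i^\star)=h_i(\mathbf{x})-h_i(\mathbf{x}_i^\star)-\langle\mathbf{v}_i^\star,\mathbf{x}-\mathbf{x}_i^\star\rangle$; $D_{f_i+h_i}=D_{f_i}+D_{h_i}$. The cumulative Bregman divergence is $\Delta^t=\sum_{i\in\mathcal V}\mathbb E[D_{f_i+h_i}(\mathbf{x}_i^t,\mathbf{x}^\star)]$. SkPD: given $\rho>0$, $\eta_i>0$, initialize $\mathbf{x}_i^1$, $\boldsymbol\lambda_{ij}^1$ and $\mathbf{h}_i^1=0\in\mathbb R^n$. For $t=1,2,\dots$, at each node $i$: pick $j_i^t\in\{1,\dots,n\}$ uniformly at random and obtain the component $[\nabla f_i(\mathbf{x}_i^t)]_{j_i^t}$; set $$\mathbf{h}_i^{t+1}=\mathbf{h}_i^t+\mathbf{e}_{j_i^t}\odot(\nabla f_i(\mathbf{x}_i^t)-\mathbf{h}_i^t),\qquad \mathbf{g}_i^t=\mathbf{h}_i^t+n\,\mathbf{e}_{j_i^t}\odot(\nabla f_i(\mathbf{x}_i^t)-\mathbf{h}_i^t),$$ where $\mathbf{e}_j$ is the $j$-th standard basis vector and $\odot$ the entrywise product; then for all $i\in\mathcal V$, $j\in\mathcal N_i$ update $$\mathbf{x}_i^{t+1}=\mathrm{prox}_{\gamma_ih_i}\Big(\tfrac{\gamma_i}{\eta_i}[\mathbf{x}_i^t-\eta_i\mathbf{g}_i^t]+\gamma_i\sum_{j\in\mathcal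 N_i}[\rho\mathbf{x}_j^t-\boldsymbol\lambda_{ji}^t]\Big),\qquad \boldsymbol\lambda_{ij}^{t+1}=-\boldsymbol\lambda_{ji}^t+\rho(\mathbf{x}_j^t-\mathbf{x}_i^{t+1}),$$ with $\gamma_i=(\frac1{\eta_i}+\rho|\mathcal N_i|)^{-1}$ and $\mathrm{prox}_{\eta h}(\mathbf{y})=\arg\min_{\mathbf{x}}h(\mathbf{x})+\frac1{2\eta}\|\mathbf{y}-\mathbf{x}\|^2$. Conventions. A sketched-gradient oracle call returns a random component of $\nabla f_i(\mathbf{x})$ for a given $\mathbf{x}$ (one call is made at every node per iteration). The sketched-gradient oracle complexity is the number of such (network-wide) oracle calls required to ensure $\min_{1\le t\le T}\Delta^t\le\epsilon$. $W_1$ is a constant with $\max_{i,j}\{\|\mathbf{x}_i^1-\mathbf{x}_i^\star\|^2,\|\boldsymbol\lambda_{ij}^1-\boldsymbol\lambda_{ij}^\star\|^2,D_{f_i+h_i}(\mathbf{x}_i^1,\mathbf{x}_i^\star)\}\le W_1$. The $O(\cdot)$ notation subsumes universal constants and initialization-dependent quantities such as $W_1$; $\rho$ is a fixed constant, so that $2E(\rho+1/\rho)+2V=O(E)$. *)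

theory Defs
  imports "HOL-Probability.Probability" "HOL-Library.Poly_Mapping"
begin

text \<open>
  The dimension \<open>n\<close> has to be quantified inside the theorem, below the constant hidden in
  \<open>O(...)\<close>; it therefore cannot be a type index as in \<open>real ^ 'n\<close>.  We use the inner product
  space of finitely supported real sequences and take \<open>\<real>\<^sup>n\<close> to be its subspace of the vectors
  supported on the coordinates \<open>1, ..., n\<close>.
\<close>

instantiation poly_mapping :: (type, real_vector) real_vector
begin

lift_definition scaleR_poly_mapping :: "real \<Rightarrow> ('a \<Rightarrow>\<^sub>0 'b) \<Rightarrow> ('a \<Rightarrow>\<^sub>0 'b)"
  is "\<lambda>r f k. r *\<^sub>R f k"
  by (erule finite_subset [rotated]) auto

instance
  by standard (transfer; simp add: fun_eq_iff scaleR_add_right scaleR_add_left)+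

end

instantiation poly_mapping :: (type, real_normed_vector) real_normed_vector
begin

definition norm_poly_mapping_def: "norm (x :: 'a \<Rightarrow>\<^sub>0 'b) = L2_set (\<lambda>k. norm (Poly_Mapping.lookup x k)) (Poly_Mapping.keys x)"

definition sgn_poly_mapping_def: "sgn (x :: 'a \<Rightarrow>\<^sub>0 'b) = inverse (norm x) *\<^sub>R x"

definition dist_poly_mapping_def: "dist (x :: 'a \<Rightarrow>\<^sub>0 'b) y = norm (x - y)"

definition uniformity_poly_mapping_def: "(uniformity :: (('a \<Rightarrow>\<^sub>0 'b) \<times> ('a \<Rightarrow>\<^sub>0 'b)) filter)
  = (INF e\<in>{0<..}. principal {(x, y). dist x y < e})"

definition open_poly_mapping_def: "open (U :: ('a \<Rightarrow>\<^sub>0 'b) set)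
  \<longleftrightarrow> (\<forall>x\<in>U. \<forall>\<^sub>F (x', y) in uniformity. x' = x \<longrightarrow> y \<in> U)"

lemma norm_poly_mapping_superset:
  fixes x :: "'a \<Rightarrow>\<^sub>0 'b"
  assumes "finite A" "Poly_Mapping.keys x \<subseteq> A"
  shows "norm x = L2_set (\<lambda>k. norm (Poly_Mapping.lookup x k)) A"
  unfolding norm_poly_mapping_def L2_set_def
  by (rule arg_cong [where f = sqrt], rule sum.mono_neutral_left)
    (use assms in \<open>auto simp: in_keys_iff\<close>)

instance
proof
  fix x y :: "'a \<Rightarrow>\<^sub>0 'b" and r :: real
  show "norm x = 0 \<longleftrightarrow> x = 0"
  proof
    assume "norm x = 0"
    then have "\<forall>k\<in>Poly_Mapping.keys x. Poly_Mapping.lookup x k = 0"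
      by (simp add: norm_poly_mapping_def L2_set_eq_0_iff)
    then show "x = 0"
      by (intro poly_mapping_eqI) (auto simp: in_keys_iff)
  qed (simp add: norm_poly_mapping_def)
  let ?A = "Poly_Mapping.keys x \<union> Poly_Mapping.keys y"
  have "norm (x + y) = L2_set (\<lambda>k. norm (Poly_Mapping.lookup (x + y) k)) ?A"
    by (rule norm_poly_mapping_superset) (simp_all add: Poly_Mapping.keys_add)
  also have "\<dots> \<le> L2_set (\<lambda>k. norm (Poly_Mapping.lookup x k) + norm (Poly_Mapping.lookup y k)) ?A"
    by (rule L2_set_mono) (simp_all add: lookup_add norm_triangle_ineq)
  also have "\<dots> \<le> L2_set (\<lambda>k. norm (Poly_Mapping.lookup x k)) ?A
      + L2_set (\<lambda>k. norm (Poly_Mapping.lookup y k)) ?A"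
    by (rule L2_set_triangle_ineq)
  also have "\<dots> = norm x + norm y"
    by (simp add: norm_poly_mapping_superset [of ?A])
  finally show "norm (x + y) \<le> norm x + norm y" .
  have "Poly_Mapping.keys (r *\<^sub>R x) \<subseteq> Poly_Mapping.keys x"
    by (auto simp: in_keys_iff scaleR_poly_mapping.rep_eq)
  then show "norm (r *\<^sub>R x) = \<bar>r\<bar> * norm x"
    by (simp add: norm_poly_mapping_superset [of "Poly_Mapping.keys x"]
        scaleR_poly_mapping.rep_eq L2_set_right_distrib)
qed (simp_all add: sgn_poly_mapping_def dist_poly_mapping_def
      uniformity_poly_mapping_def open_poly_mapping_def)

end

instantiation poly_mapping :: (type, real_inner) real_inner
begin

definition inner_poly_mapping_def: "inner x y =
    (\<Sum>k\<in>Poly_Mapping.keys x. inner (Poly_Mapping.lookup x k) (Poly_Mapping.lookup y k))"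

lemma inner_poly_mapping_superset:
  fixes x y :: "'a \<Rightarrow>\<^sub>0 'b"
  assumes "finite A" "Poly_Mapping.keys x \<subseteq> A"
  shows "inner x y = (\<Sum>k\<in>A. inner (Poly_Mapping.lookup x k) (Poly_Mapping.lookup y k))"
  unfolding inner_poly_mapping_def
  by (rule sum.mono_neutral_left) (use assms in \<open>auto simp: in_keys_iff\<close>)

instance
proof
  fix x y z :: "'a \<Rightarrow>\<^sub>0 'b" and r :: real
  show "inner x y = inner y x"
    using inner_poly_mapping_superset [of "Poly_Mapping.keys x \<union> Poly_Mapping.keys y" x y]
      inner_poly_mapping_superset [of "Poly_Mapping.keys x \<union> Poly_Mapping.keys y" y x]
    by (simp add: inner_commute)
  have "Poly_Mapping.keys (x + y) \<subseteq> Poly_Mapping.keys x \<union> Poly_Mapping.keys y"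
    by (rule Poly_Mapping.keys_add)
  then show "inner (x + y) z = inner x z + inner y z"
    using inner_poly_mapping_superset [of "Poly_Mapping.keys x \<union> Poly_Mapping.keys y" x z]
      inner_poly_mapping_superset [of "Poly_Mapping.keys x \<union> Poly_Mapping.keys y" y z]
      inner_poly_mapping_superset [of "Poly_Mapping.keys x \<union> Poly_Mapping.keys y" "x + y" z]
    by (simp add: lookup_add inner_add_left sum.distrib)
  have "Poly_Mapping.keys (r *\<^sub>R x) \<subseteq> Poly_Mapping.keys x"
    by (auto simp: in_keys_iff scaleR_poly_mapping.rep_eq)
  then show "inner (r *\<^sub>R x) y = r * inner x y"
    using inner_poly_mapping_superset [of "Poly_Mapping.keys x" x y]
      inner_poly_mapping_superset [of "Poly_Mapping.keys x" "r *\<^sub>R x" y]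
    by (simp add: scaleR_poly_mapping.rep_eq sum_distrib_left)
  show "0 \<le> inner x x"
    by (simp add: inner_poly_mapping_def sum_nonneg)
  show "inner x x = 0 \<longleftrightarrow> x = 0"
  proof
    assume "inner x x = 0"
    then have "\<forall>k\<in>Poly_Mapping.keys x. Poly_Mapping.lookup x k = 0"
      by (simp add: inner_poly_mapping_def sum_nonneg_eq_0_iff)
    then show "x = 0"
      by (intro poly_mapping_eqI) (auto simp: in_keys_iff)
  qed (simp add: inner_poly_mapping_def)
  show "norm x = sqrt (inner x x)"
    by (simp add: norm_poly_mapping_def inner_poly_mapping_def L2_set_def power2_norm_eq_inner)
qed

end

type_synonym rvec = "nat \<Rightarrow>\<^sub>0 real"

definition Rn :: "nat \<Rightarrow> rvec set"
  where "Rn n = {x. Poly_Mapping.keys x \<subseteq> {1..n}}"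

definition unit_vector :: "nat \<Rightarrow> rvec"
  where "unit_vector j = Poly_Mapping.single j 1"

text \<open>Multiplication on \<^typ>\<open>rvec\<close> in the library is convolution, not the entrywise product.\<close>

definition entrywise :: "rvec \<Rightarrow> rvec \<Rightarrow> rvec"  (infixl "\<odot>" 70)
  where "u \<odot> v = Poly_Mapping.mapp (\<lambda>k a. a * Poly_Mapping.lookup v k) u"

subsection \<open>Convex analysis on \<open>\<real>\<^sup>n\<close>\<close>

text \<open>Only the values of a function on \<^term>\<open>Rn n\<close> matter in the following notions.\<close>

definition epi :: "nat \<Rightarrow> (rvec \<Rightarrow> ereal) \<Rightarrow> (rvec \<times> real) set"
  where "epi n h = {(x, r). x \<in> Rn n \<and> h x \<le> ereal r}"

definition proper :: "nat \<Rightarrow> (rvec \<Rightarrow> ereal) \<Rightarrow> bool"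
  where "proper n h \<longleftrightarrow> (\<forall>x\<in>Rn n. h x \<noteq> -\<infinity>) \<and> (\<exists>x\<in>Rn n. h x \<noteq> \<infinity>)"

definition proper_closed_convex :: "nat \<Rightarrow> (rvec \<Rightarrow> ereal) \<Rightarrow> bool"
  where "proper_closed_convex n h \<longleftrightarrow> proper n h \<and> closed (epi n h) \<and> convex (epi n h)"

definition has_gradient :: "nat \<Rightarrow> (rvec \<Rightarrow> real) \<Rightarrow> rvec \<Rightarrow> rvec \<Rightarrow> bool"
  where "has_gradient n f x g \<longleftrightarrow>
    g \<in> Rn n \<and> (f has_derivative (\<lambda>d. inner g d)) (at x within Rn n)"

definition grad :: "nat \<Rightarrow> (rvec \<Rightarrow> real) \<Rightarrow> rvec \<Rightarrow> rvec"
  where "grad n f x = (THE g. has_gradient n f x g)"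

definition L_smooth :: "nat \<Rightarrow> real \<Rightarrow> (rvec \<Rightarrow> real) \<Rightarrow> bool"
  where "L_smooth n L f \<longleftrightarrow>
    (\<forall>x\<in>Rn n. \<exists>g. has_gradient n f x g) \<and> lipschitz_on L (Rn n) (grad n f)"

definition subdifferential :: "nat \<Rightarrow> (rvec \<Rightarrow> ereal) \<Rightarrow> rvec \<Rightarrow> rvec set"
  where "subdifferential n h x =
    {v \<in> Rn n. \<forall>y\<in>Rn n. h x + ereal (inner v (y - x)) \<le> h y}"

text \<open>\<open>prox n \<gamma> h y\<close> is \<open>prox\<^bsub>\<gamma>h\<^esub>(y)\<close>.\<close>

definition prox :: "nat \<Rightarrow> real \<Rightarrow> (rvec \<Rightarrow> ereal) \<Rightarrow> rvec \<Rightarrow> rvec"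
  where "prox n \<gamma> h y =
    arg_min (\<lambda>x. h x + ereal (1 / (2 * \<gamma>) * (norm (y - x))\<^sup>2)) (\<lambda>x. x \<in> Rn n)"

definition bregman_smooth :: "nat \<Rightarrow> (rvec \<Rightarrow> real) \<Rightarrow> rvec \<Rightarrow> rvec \<Rightarrow> real"
  where "bregman_smooth n f x y = f x - f y - inner (grad n f y) (x - y)"

definition bregman_subgrad :: "(rvec \<Rightarrow> ereal) \<Rightarrow> rvec \<Rightarrow> rvec \<Rightarrow> rvec \<Rightarrow> ereal"
  where "bregman_subgrad h v x y = h x - h y - ereal (inner v (x - y))"

definition bregman ::
  "nat \<Rightarrow> (rvec \<Rightarrow> real) \<Rightarrow> (rvec \<Rightarrow> ereal) \<Rightarrow> rvec \<Rightarrow> rvec \<Rightarrow> rvec \<Rightarrow> ereal"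
  where "bregman n f h v x y = ereal (bregman_smooth n f x y) + bregman_subgrad h v x y"

subsection \<open>The network and the consensus problem\<close>

text \<open>Nodes are the elements of a finite set \<open>V :: 'v set\<close>, edges are two-element sets.  With an
  infinite \<open>'v\<close>, such as \<^typ>\<open>nat\<close>, networks of all sizes live in one type, so a constant chosen
  before \<open>V\<close> is uniform in the size of the network.\<close>

definition connected_graph :: "'v set \<Rightarrow> 'v set set \<Rightarrow> bool"
  where "connected_graph V E \<longleftrightarrow>
    finite V \<and> V \<noteq> {} \<and>
    (\<forall>e\<in>E. \<exists>i\<in>V. \<exists>j\<in>V. i \<noteq> j \<and> e = {i, j}) \<and>
    (\<forall>i\<in>V. \<forall>j\<in>V. (i, j) \<in> {(a, b). {a, b} \<in> E}\<^sup>*)"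

definition nbrs :: "'v set set \<Rightarrow> 'v \<Rightarrow> 'v set"
  where "nbrs E i = {j. {i, j} \<in> E}"

text \<open>\<open>F i k\<close> stands for \<open>f\<^sub>i(\<cdot>, \<xi>\<^sub>i\<^sup>k)\<close>.\<close>

definition avg :: "('v \<Rightarrow> nat) \<Rightarrow> ('v \<Rightarrow> nat \<Rightarrow> rvec \<Rightarrow> real) \<Rightarrow> 'v \<Rightarrow> rvec \<Rightarrow> real"
  where "avg K F i x = 1 / real (K i) * (\<Sum>k = 1..K i. F i k x)"

definition consensus_solution ::
  "'v set \<Rightarrow> 'v set set \<Rightarrow> nat \<Rightarrow> ('v \<Rightarrow> rvec \<Rightarrow> real) \<Rightarrow> ('v \<Rightarrow> rvec \<Rightarrow> ereal) \<Rightarrow>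
    ('v \<Rightarrow> rvec) \<Rightarrow> bool"
  where "consensus_solution V E n f h x \<longleftrightarrow>
    is_arg_min (\<lambda>y. \<Sum>i\<in>V. ereal (f i (y i)) + h i (y i))
      (\<lambda>y. (\<forall>i\<in>V. y i \<in> Rn n) \<and> (\<forall>i j. {i, j} \<in> E \<longrightarrow> y i = y j)) x"

definition kkt_point ::
  "'v set \<Rightarrow> 'v set set \<Rightarrow> nat \<Rightarrow> ('v \<Rightarrow> rvec \<Rightarrow> real) \<Rightarrow> ('v \<Rightarrow> rvec \<Rightarrow> ereal) \<Rightarrow>
    ('v \<Rightarrow> rvec) \<Rightarrow> ('v \<Rightarrow> 'v \<Rightarrow> rvec) \<Rightarrow> ('v \<Rightarrow> rvec) \<Rightarrow> bool"
  where "kkt_point V E n f h x l v \<longleftrightarrow>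
    (\<forall>i\<in>V. x i \<in> Rn n) \<and>
    (\<forall>i\<in>V. \<forall>j\<in>nbrs E i. l i j \<in> Rn n) \<and>
    (\<forall>i\<in>V. v i \<in> subdifferential n (h i) (x i)) \<and>
    (\<forall>i\<in>V. \<forall>j\<in>nbrs E i. x i = x j) \<and>
    (\<forall>i\<in>V. \<forall>j\<in>nbrs E i. l i j + l j i = 0) \<and>
    (\<forall>i\<in>V. v i + grad n (f i) (x i) + (\<Sum>j\<in>nbrs E i. l j i) = 0)"

subsection \<open>The algorithm SkPD\<close>

record 'v skpd_state =
  primal :: "'v \<Rightarrow> rvec"
  dual :: "'v \<Rightarrow> 'v \<Rightarrow> rvec"
  memory :: "'v \<Rightarrow> rvec"

text \<open>One iteration, for given sampled coordinates \<open>J i\<close>.  Only the components of the state at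
  nodes of \<open>V\<close> and at pairs of neighbours are meaningful.\<close>

definition skpd_step ::
  "'v set set \<Rightarrow> nat \<Rightarrow> real \<Rightarrow> ('v \<Rightarrow> real) \<Rightarrow> ('v \<Rightarrow> rvec \<Rightarrow> real) \<Rightarrow> ('v \<Rightarrow> rvec \<Rightarrow> ereal) \<Rightarrow>
    ('v \<Rightarrow> nat) \<Rightarrow> 'v skpd_state \<Rightarrow> 'v skpd_state"
  where "skpd_step E n \<rho> \<eta> f h J s =
    (let x = primal s; l = dual s; m = memory s;
         m' = (\<lambda>i. m i + unit_vector (J i) \<odot> (grad n (f i) (x i) - m i));
         g = (\<lambda>i. m i + real n *\<^sub>R (unit_vector (J i) \<odot> (grad n (f i) (x i) - m i)));
         \<gamma> = (\<lambda>i. inverse (1 / \<eta> i + \<rho> * real (card (nbrs E i))));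
         x' = (\<lambda>i. prox n (\<gamma> i) (h i)
                ((\<gamma> i / \<eta> i) *\<^sub>R (x i - \<eta> i *\<^sub>R g i)
                  + \<gamma> i *\<^sub>R (\<Sum>j\<in>nbrs E i. \<rho> *\<^sub>R x j - l j i)));
         l' = (\<lambda>i j. - l j i + \<rho> *\<^sub>R (x j - x' i))
     in \<lparr>primal = x', dual = l', memory = m'\<rparr>)"

definition sampling :: "'v set \<Rightarrow> nat \<Rightarrow> ('v \<Rightarrow> nat) pmf"
  where "sampling V n = Pi_pmf V 0 (\<lambda>_. pmf_of_set {1..n})"

text \<open>The law of the state at iteration \<open>t \<ge> 1\<close>, where \<open>s1\<close> is the state at iteration \<open>1\<close>; the
  coordinates are drawn independently over nodes and iterations.\<close>

definition skpd_law ::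
  "'v set \<Rightarrow> 'v set set \<Rightarrow> nat \<Rightarrow> real \<Rightarrow> ('v \<Rightarrow> real) \<Rightarrow> ('v \<Rightarrow> rvec \<Rightarrow> real) \<Rightarrow>
    ('v \<Rightarrow> rvec \<Rightarrow> ereal) \<Rightarrow> 'v skpd_state \<Rightarrow> nat \<Rightarrow> 'v skpd_state pmf"
  where "skpd_law V E n \<rho> \<eta> f h s1 t =
    ((\<lambda>p. do {s \<leftarrow> p; J \<leftarrow> sampling V n; return_pmf (skpd_step E n \<rho> \<eta> f h J s)}) ^^ (t - 1))
      (return_pmf s1)"

text \<open>The expected Bregman divergence of a law.  For convex \<open>f i\<close> and \<open>v i \<in> \<partial>h\<^sub>i(x\<^sub>i)\<close> the
  divergences are nonnegative and \<open>e2ennreal\<close> truncates nothing, while an infinite value of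
  \<open>h i\<close> on the support of the law would make the expectation infinite.\<close>

definition expected_bregman ::
  "'v set \<Rightarrow> nat \<Rightarrow> ('v \<Rightarrow> rvec \<Rightarrow> real) \<Rightarrow> ('v \<Rightarrow> rvec \<Rightarrow> ereal) \<Rightarrow>
    ('v \<Rightarrow> rvec) \<Rightarrow> ('v \<Rightarrow> rvec) \<Rightarrow> 'v skpd_state pmf \<Rightarrow> ennreal"
  where "expected_bregman V n f h x v p =
    (\<Sum>i\<in>V. \<integral>\<^sup>+ s. e2ennreal (bregman n (f i) (h i) (v i) (primal s i) (x i)) \<partial>measure_pmf p)"

text \<open>The least number \<open>T\<close> of (network-wide) oracle calls such that
  \<open>min\<^bsub>1 \<le> t \<le> T\<^esub> \<Delta> t \<le> \<epsilon>\<close>, and \<open>\<infinity>\<close> if there is none.  Each iteration makes one such call.  Since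
  the minimum ranges over \<open>1 \<le> t \<le> T\<close>, the number is at least \<open>1\<close>.\<close>

definition oracle_complexity :: "(nat \<Rightarrow> ennreal) \<Rightarrow> real \<Rightarrow> enat"
  where "oracle_complexity \<Delta> \<epsilon> =
    Inf {enat T | T. T \<ge> 1 \<and> (MIN t\<in>{1..T}. \<Delta> t) \<le> ennreal \<epsilon>}"

end

theory Submission
  imports Defs
begin

text \<open>
  Write \<open>X\<^sub>i = x\<^sub>i - x\<^sup>\<star>\<close>, \<open>a\<^sub>i\<^sub>j = \<lambda>\<^sub>i\<^sub>j - \<lambda>\<^sup>\<star>\<^sub>i\<^sub>j\<close>, \<open>m\<^sub>i\<close> for the memory (the paper's bold \<open>h\<^sub>i\<close>),
  and consider the energy
  \<open>\<Sum>\<^sub>i (|X\<^sub>i|\<^sup>2 / (2\<eta>) + \<eta> n\<^sup>2 |m\<^sub>i - \<nabla>f\<^sub>i(x\<^sup>\<star>)|\<^sup>2) + \<Sum>\<^sub>i\<^sub>j |a\<^sub>i\<^sub>j - \<rho> X\<^sub>i|\<^sup>2 / (4\<rho>)\<close>.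
  The optimality condition of the proximal step and the KKT conditions bound \<open>D\<^sub>h\<close> after the step
  by inner products.  The edge terms telescope exactly, and the cross term with the sketched
  gradient is split by Young's inequality, which uses up \<open>|x\<^sub>i\<^sup>t\<^sup>+\<^sup>1 - x\<^sub>i\<^sup>t|\<^sup>2 / (2\<eta>)\<close>.  The second moment of
  the sketched gradient is at most \<open>2n (|\<nabla>f\<^sub>i(x\<^sub>i) - \<nabla>f\<^sub>i(x\<^sup>\<star>)|\<^sup>2 + |m\<^sub>i - \<nabla>f\<^sub>i(x\<^sup>\<star>)|\<^sup>2)\<close>; the memory
  contracts by the factor \<open>1 - 1/n\<close>, and cocoercivity of \<open>\<nabla>f\<^sub>i\<close> absorbs the rest because
  \<open>2 \<eta> n = 1/(4L)\<close>.  Hence in expectation the energy decreases by at least \<open>D\<^sub>f\<close> at the old plus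
  \<open>D\<^sub>h\<close> at the new iterate, so that the sum of all \<open>\<Delta>\<^sup>t\<close> is bounded by the initial energy plus
  \<open>D\<^sub>h\<close> at the initial point.
\<close>

subsection \<open>The coordinate space\<close>

lemma subspace_Rn: "subspace (Rn n)"
proof (rule subspaceI)
  fix x y :: rvec and c :: real
  show "0 \<in> Rn n" by (simp add: Rn_def)
  show "x \<in> Rn n \<Longrightarrow> y \<in> Rn n \<Longrightarrow> x + y \<in> Rn n"
    using Poly_Mapping.keys_add[of x y] by (auto simp: Rn_def)
  show "x \<in> Rn n \<Longrightarrow> c *\<^sub>R x \<in> Rn n"
    by (auto simp: Rn_def in_keys_iff scaleR_poly_mapping.rep_eq)
qed

lemmas Rn_closed_intros =
  subspace_0[OF subspace_Rn] subspace_add[OF subspace_Rn] subspace_diff[OF subspace_Rn]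
  subspace_scale[OF subspace_Rn] subspace_neg[OF subspace_Rn] subspace_sum[OF subspace_Rn]

lemma lookup_eq_0_Rn: "x \<in> Rn n \<Longrightarrow> k \<notin> {1..n} \<Longrightarrow> Poly_Mapping.lookup x k = 0"
  by (auto simp: Rn_def in_keys_iff)

lemma inner_Rn:
  assumes "x \<in> Rn n"
  shows "inner x y = (\<Sum>k\<in>{1..n}. Poly_Mapping.lookup x k * Poly_Mapping.lookup y k)"
  using inner_poly_mapping_superset[of "{1..n}" x y] assms by (simp add: Rn_def)

lemma norm_Rn:
  assumes "x \<in> Rn n"
  shows "norm x = L2_set (Poly_Mapping.lookup x) {1..n}"
proof -
  have "norm x = L2_set (\<lambda>k. norm (Poly_Mapping.lookup x k)) {1..n}"
    by (rule norm_poly_mapping_superset) (use assms in \<open>simp_all add: Rn_def\<close>)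
  then show ?thesis by (simp add: L2_set_def)
qed

lemma abs_lookup_le_norm:
  fixes x :: rvec
  shows "\<bar>Poly_Mapping.lookup x k\<bar> \<le> norm x"
proof (cases "k \<in> Poly_Mapping.keys x")
  case True
  then show ?thesis
    unfolding norm_poly_mapping_def
    using member_le_L2_set[of "Poly_Mapping.keys x" k "\<lambda>k. norm (Poly_Mapping.lookup x k)"] by simp
qed (simp add: in_keys_iff)

text \<open>The space of all finitely supported sequences is not complete, but the coordinate
  subspace is: coordinates of a Cauchy sequence converge in the reals, and only finitely many of
  them matter. This provides limits of minimizing sequences for the proximal operator.\<close>

lemma complete_Rn: "Topological_Spaces.complete (Rn n)"
proof (rule completeI)
  fix a :: "nat \<Rightarrow> rvec"
  assume a: "\<forall>m. a m \<in> Rn n" and C: "Cauchy a"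
  have "convergent (\<lambda>m. Poly_Mapping.lookup (a m) k)" for k
  proof (rule real_Cauchy_convergent, rule CauchyI)
    fix e :: real assume "e > 0"
    then obtain M where M: "\<forall>m\<ge>M. \<forall>p\<ge>M. norm (a m - a p) < e"
      using CauchyD[OF C] by blast
    show "\<exists>M. \<forall>m\<ge>M. \<forall>p\<ge>M. norm (Poly_Mapping.lookup (a m) k - Poly_Mapping.lookup (a p) k) < e"
    proof (intro exI allI impI)
      fix m p assume "m \<ge> M" "p \<ge> M"
      then have "norm (a m - a p) < e" using M by blast
      then show "norm (Poly_Mapping.lookup (a m) k - Poly_Mapping.lookup (a p) k) < e"
        using abs_lookup_le_norm[of "a m - a p" k] by (simp add: lookup_minus)
    qed
  qed
  then obtain l where l: "(\<lambda>m. Poly_Mapping.lookup (a m) k) \<longlonglongrightarrow> l k" for k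
    unfolding convergent_def by metis
  define b :: rvec where "b = (\<Sum>k\<in>{1..n}. Poly_Mapping.single k (l k))"
  have b: "b \<in> Rn n"
    unfolding b_def by (intro Rn_closed_intros) (auto simp: Rn_def in_keys_iff lookup_single when_def)
  have lb: "Poly_Mapping.lookup b k = l k" if "k \<in> {1..n}" for k
    using that unfolding b_def by (simp add: lookup_sum lookup_single when_def sum.delta)
  have "(\<lambda>m. L2_set (Poly_Mapping.lookup (a m - b)) {1..n}) \<longlonglongrightarrow> sqrt (\<Sum>k\<in>{1..n}. (l k - l k)\<^sup>2)"
    unfolding L2_set_def lookup_minus
    by (intro tendsto_intros l) (auto simp: lb intro!: tendsto_intros l)
  moreover have "norm (a m - b) = L2_set (Poly_Mapping.lookup (a m - b)) {1..n}" for m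
    by (rule norm_Rn) (use a b in \<open>auto intro: Rn_closed_intros\<close>)
  ultimately have "(\<lambda>m. norm (a m - b)) \<longlonglongrightarrow> 0"
    by simp
  then have "a \<longlonglongrightarrow> b"
    using tendsto_norm_zero_iff LIM_zero_cancel by blast
  with b show "\<exists>l\<in>Rn n. a \<longlonglongrightarrow> l" by blast
qed

section \<open>Coordinate masks and their moments\<close>

lemma lookup_unit_vector_entrywise:
  "Poly_Mapping.lookup (unit_vector j \<odot> a) k = (if k = j then Poly_Mapping.lookup a j else 0)"
  by (auto simp: entrywise_def unit_vector_def lookup_mapp lookup_single when_def)

lemma unit_vector_entrywise_Rn: "a \<in> Rn n \<Longrightarrow> unit_vector j \<odot> a \<in> Rn n"
  by (auto simp: Rn_def in_keys_iff lookup_unit_vector_entrywise split: if_splits)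

text \<open>Divided by \<open>n\<close>, this identity and the Pythagorean one after it are the mean
  and the second moment of a uniformly sampled coordinate of \<open>a\<close>.\<close>

lemma sum_unit_vector_entrywise:
  assumes "a \<in> Rn n"
  shows "(\<Sum>j\<in>{1..n}. unit_vector j \<odot> a) = a"
proof (rule poly_mapping_eqI)
  fix k
  show "Poly_Mapping.lookup (\<Sum>j\<in>{1..n}. unit_vector j \<odot> a) k = Poly_Mapping.lookup a k"
    using lookup_eq_0_Rn[OF assms, of k]
    by (simp add: lookup_sum lookup_unit_vector_entrywise sum.delta)
qed

lemma sum_norm_unit_vector_entrywise:
  assumes "a \<in> Rn n"
  shows "(\<Sum>j\<in>{1..n}. (norm (unit_vector j \<odot> a))\<^sup>2) = (norm a)\<^sup>2"
proof -
  have "(norm (unit_vector j \<odot> a))\<^sup>2 = (Poly_Mapping.lookup a j)\<^sup>2" if "j \<in> {1..n}" for j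
  proof -
    have "inner (unit_vector j \<odot> a) (unit_vector j \<odot> a)
      = (\<Sum>k\<in>{1..n}. if k = j then Poly_Mapping.lookup a j * Poly_Mapping.lookup a j else 0)"
      unfolding inner_Rn[OF unit_vector_entrywise_Rn[OF assms]]
      by (rule sum.cong) (auto simp: lookup_unit_vector_entrywise)
    then show ?thesis
      unfolding power2_norm_eq_inner using that by (simp add: power2_eq_square)
  qed
  then have "(\<Sum>j\<in>{1..n}. (norm (unit_vector j \<odot> a))\<^sup>2) = (\<Sum>j\<in>{1..n}. (Poly_Mapping.lookup a j)\<^sup>2)"
    by (rule sum.cong[OF refl])
  also have "\<dots> = (norm a)\<^sup>2"
    unfolding power2_norm_eq_inner inner_Rn[OF assms] by (simp add: power2_eq_square)
  finally show ?thesis .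
qed

subsection \<open>Convex and smooth functions\<close>

lemma convex_on_epi:
  assumes "convex (epi n (\<lambda>x. ereal (f x)))"
  shows "convex_on (Rn n) f"
proof (rule convex_onI)
  fix t x y assume *: "0 < t" "t < (1::real)" "x \<in> Rn n" "y \<in> Rn n"
  have "(1 - t) *\<^sub>R (x, f x) + t *\<^sub>R (y, f y) \<in> epi n (\<lambda>x. ereal (f x))"
    by (rule convexD[OF assms]) (use * in \<open>auto simp: epi_def\<close>)
  then show "f ((1 - t) *\<^sub>R x + t *\<^sub>R y) \<le> (1 - t) * f x + t * f y"
    by (simp add: epi_def)
qed (simp add: subspace_imp_convex subspace_Rn)

text \<open>Chain rule along a line that stays in \<open>Rn n\<close>; it reduces convexity and
  smoothness arguments to calculus in one variable.\<close>

lemma has_gradient_line: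
  assumes "has_gradient n f (x + t *\<^sub>R d) g" "x \<in> Rn n" "d \<in> Rn n"
  shows "((\<lambda>t. f (x + t *\<^sub>R d)) has_real_derivative inner g d) (at t within A)"
proof -
  have "((\<lambda>t. x + t *\<^sub>R d) has_derivative (\<lambda>s. s *\<^sub>R d)) (at t within A)"
    by (auto intro!: derivative_eq_intros)
  moreover have "(f has_derivative (\<lambda>d. inner g d)) (at (x + t *\<^sub>R d) within (\<lambda>t. x + t *\<^sub>R d) ` A)"
    using assms unfolding has_gradient_def
    by (auto intro: has_derivative_subset Rn_closed_intros)
  ultimately have "(f \<circ> (\<lambda>t. x + t *\<^sub>R d) has_derivative (\<lambda>d. inner g d) \<circ> (\<lambda>s. s *\<^sub>R d)) (at t within A)"
    by (rule diff_chain_within)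
  then show ?thesis
    by (simp add: has_field_derivative_def o_def mult_commute_abs)
qed

text \<open>The derivative within \<open>Rn n\<close> only sees directions of \<open>Rn n\<close>.
  Since gradients are required to lie there, testing in the direction \<open>g - g'\<close>
  separates them; this justifies the definite description in \<open>grad\<close>.\<close>

lemma has_gradient_unique:
  assumes "has_gradient n f x g" "has_gradient n f x g'" "x \<in> Rn n"
  shows "g = g'"
proof -
  have d: "g - g' \<in> Rn n"
    using assms unfolding has_gradient_def by (auto intro: Rn_closed_intros)
  have "inner g (g - g') = inner g' (g - g')"
    using has_gradient_line[of n f x 0 "g - g'" g UNIV] has_gradient_line[of n f x 0 "g - g'" g' UNIV] 
      assms d by (intro DERIV_unique) auto
  then have "inner (g - g') (g - g') = 0"
    by (simp add: inner_diff_left)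
  then show ?thesis by simp
qed

lemma grad_eqI: "has_gradient n f x g \<Longrightarrow> x \<in> Rn n \<Longrightarrow> grad n f x = g"
  unfolding grad_def using has_gradient_unique by (blast intro: the_equality)

lemma L_smooth_has_gradient:
  "L_smooth n L f \<Longrightarrow> x \<in> Rn n \<Longrightarrow> has_gradient n f x (grad n f x)"
  unfolding L_smooth_def using grad_eqI by metis

lemma L_smooth_grad_Rn: "L_smooth n L f \<Longrightarrow> x \<in> Rn n \<Longrightarrow> grad n f x \<in> Rn n"
  using L_smooth_has_gradient has_gradient_def by blast

text \<open>On the line from \<open>y\<close> to \<open>x\<close> the function is convex in one
  variable and lies above its tangent at parameter 0; compare at parameter 1.\<close>

lemma bregman_smooth_nonneg:
  assumes "L_smooth n L f" "convex_on (Rn n) f" "x \<in> Rn n" "y \<in> Rn n"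
  shows "bregman_smooth n f x y \<ge> 0"
proof -
  let ?p = "\<lambda>t. f (y + t *\<^sub>R (x - y))"
  have d: "x - y \<in> Rn n" using assms by (intro Rn_closed_intros)
  have "convex_on UNIV ?p"
  proof (rule convex_onI)
    fix t a b :: real assume t: "0 < t" "t < 1"
    have "?p ((1 - t) *\<^sub>R a + t *\<^sub>R b)
      = f ((1 - t) *\<^sub>R (y + a *\<^sub>R (x - y)) + t *\<^sub>R (y + b *\<^sub>R (x - y)))"
      by (rule arg_cong[where f = f]) (simp add: algebra_simps)
    also have "\<dots> \<le> (1 - t) * ?p a + t * ?p b"
      using t d assms by (intro convex_onD[OF assms(2)]) (auto intro!: Rn_closed_intros)
    finally show "?p ((1 - t) *\<^sub>R a + t *\<^sub>R b) \<le> (1 - t) * ?p a + t * ?p b" .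
  qed simp
  moreover have "(?p has_real_derivative inner (grad n f y) (x - y)) (at 0 within UNIV)"
    by (rule has_gradient_line) (use assms d L_smooth_has_gradient in auto)
  ultimately have "?p 1 - ?p 0 \<ge> inner (grad n f y) (x - y) * (1 - 0)"
    by (intro convex_on_imp_above_tangent[where A = UNIV]) auto
  then show ?thesis by (simp add: bregman_smooth_def)
qed

lemma descent_inequality:
  assumes "L_smooth n L f" "x \<in> Rn n" "y \<in> Rn n"
  shows "f x \<le> f y + inner (grad n f y) (x - y) + L / 2 * (norm (x - y))\<^sup>2"
proof -
  let ?d = "x - y"
  \<comment> \<open>\<open>?p\<close> is \<open>f\<close> along the segment minus the increment of
    its quadratic upper model. Lipschitz continuity of the gradient makes its derivative nonpositive
    on the unit interval.\<close>
  let ?p = "\<lambda>t. f (y + t *\<^sub>R ?d) - t * inner (grad n f y) ?d - L / 2 * t\<^sup>2 * (norm ?d)\<^sup>2"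
  have d: "?d \<in> Rn n" using assms by (intro Rn_closed_intros)
  have "?p 1 \<le> ?p 0"
  proof (rule DERIV_nonpos_imp_nonincreasing[of 0 1 ?p])
    fix t :: real assume t: "0 \<le> t" "t \<le> 1"
    let ?g = "grad n f (y + t *\<^sub>R ?d)"
    have z: "y + t *\<^sub>R ?d \<in> Rn n" using assms d by (intro Rn_closed_intros)
    have "((\<lambda>t. f (y + t *\<^sub>R ?d)) has_real_derivative inner ?g ?d) (at t)"
      by (rule has_gradient_line[OF L_smooth_has_gradient]) (use assms d z in auto)
    then have "(?p has_real_derivative inner ?g ?d - inner (grad n f y) ?d - L * t * (norm ?d)\<^sup>2) (at t)"
      by (auto intro!: derivative_eq_intros)
    moreover have "inner (?g - grad n f y) ?d \<le> L * t * (norm ?d)\<^sup>2"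
    proof -
      have "inner (?g - grad n f y) ?d \<le> norm (?g - grad n f y) * norm ?d"
        by (rule norm_cauchy_schwarz)
      also have "norm (?g - grad n f y) \<le> L * norm (t *\<^sub>R ?d)"
        using lipschitz_onD[of L "Rn n" "grad n f" "y + t *\<^sub>R ?d" y] assms z
        by (simp add: L_smooth_def dist_norm)
      finally show ?thesis using t by (simp add: power2_eq_square mult_right_mono mult.assoc)
    qed
    ultimately show "\<exists>D. (?p has_real_derivative D) (at t) \<and> D \<le> 0"
      by (auto simp: inner_diff_left)
  qed simp
  then show ?thesis by simp
qed

text \<open>The convex function \<open>f - \<langle>\<nabla>f(y), \<cdot>\<rangle>\<close> is minimal at \<open>y\<close>; compare its value there with
  the value after a gradient step of length \<open>1/L\<close> from \<open>x\<close>.\<close>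

lemma norm_grad_diff_le_bregman:
  assumes "L_smooth n L f" "convex_on (Rn n) f" "x \<in> Rn n" "y \<in> Rn n" "L > 0"
  shows "(norm (grad n f x - grad n f y))\<^sup>2 \<le> 2 * L * bregman_smooth n f x y"
proof -
  define d where "d = grad n f x - grad n f y"
  define z where "z = x - (1 / L) *\<^sub>R d"
  have z: "z \<in> Rn n"
    using assms L_smooth_grad_Rn unfolding z_def d_def by (intro Rn_closed_intros) auto
  have "0 \<le> f z - f y - inner (grad n f y) (z - y)"
    using bregman_smooth_nonneg[OF assms(1,2) z assms(4)] by (simp add: bregman_smooth_def)
  also have "f z \<le> f x + inner (grad n f x) (z - x) + L / 2 * (norm (z - x))\<^sup>2"
    by (rule descent_inequality[OF assms(1) z assms(3)])
  also have "L / 2 * (norm (z - x))\<^sup>2 = (norm d)\<^sup>2 / (2 * L)"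
    using assms(5) by (simp add: z_def power_divide) (simp add: power2_eq_square field_simps)
  also have "inner (grad n f x) (z - x) = inner (grad n f y) (z - x) - (norm d)\<^sup>2 / L"
    by (simp add: z_def d_def power2_norm_eq_inner inner_diff_left inner_diff_right
        inner_commute[of "grad n f y" "grad n f x"] add_divide_distrib diff_divide_distrib)
  finally have "(norm d)\<^sup>2 / L - (norm d)\<^sup>2 / (2 * L) \<le> bregman_smooth n f x y"
    by (simp add: bregman_smooth_def inner_diff_right)
  then have "(norm d)\<^sup>2 / (2 * L) \<le> bregman_smooth n f x y"
    using assms(5) by (simp add: field_simps)
  then show ?thesis
    using assms(5) by (simp add: d_def field_simps)
qed

text \<open>The inner product is the symmetrized divergence, from \<open>x\<close> to
  \<open>y\<close> plus from \<open>y\<close> to \<open>x\<close>. Only the second is traded for the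
  gradient difference; the first is kept as the decrease gained per iteration.\<close>

lemma grad_diff_inner_ge:
  assumes "L_smooth n L f" "convex_on (Rn n) f" "x \<in> Rn n" "y \<in> Rn n" "L > 0"
  shows "bregman_smooth n f x y + (norm (grad n f x - grad n f y))\<^sup>2 / (2 * L)
    \<le> inner (grad n f x - grad n f y) (x - y)"
proof -
  have "(norm (grad n f y - grad n f x))\<^sup>2 / (2 * L) \<le> bregman_smooth n f y x"
    using norm_grad_diff_le_bregman[OF assms(1,2,4,3,5)] assms(5) by (simp add: field_simps)
  then show ?thesis
    by (simp add: bregman_smooth_def norm_minus_commute inner_diff_left inner_diff_right)
qed

section \<open>Averages of smooth convex functions\<close>

lemma convex_on_sum_functions:
  fixes f :: "'a \<Rightarrow> 'b :: real_vector \<Rightarrow> real"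
  assumes "finite A" "convex S" "\<And>k. k \<in> A \<Longrightarrow> convex_on S (f k)"
  shows "convex_on S (\<lambda>x. \<Sum>k\<in>A. f k x)"
  using assms by (induction A rule: finite_induct) (auto simp: convex_on_const)

lemma convex_on_avg:
  assumes "\<And>k. k \<in> {1..K i} \<Longrightarrow> convex_on (Rn n) (F i k)"
  shows "convex_on (Rn n) (avg K F i)"
  unfolding avg_def [abs_def]
  by (intro convex_on_cmul convex_on_sum_functions)
    (use assms in \<open>auto simp: subspace_imp_convex subspace_Rn\<close>)

lemma has_gradient_avg:
  assumes "K i \<ge> 1" and "\<And>k. k \<in> {1..K i} \<Longrightarrow> has_gradient n (F i k) x (g k)"
  shows "has_gradient n (avg K F i) x ((1 / real (K i)) *\<^sub>R (\<Sum>k = 1..K i. g k))"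
  using assms unfolding has_gradient_def avg_def [abs_def]
  by (auto intro!: Rn_closed_intros derivative_eq_intros simp: inner_sum_left)

lemma L_smooth_avg:
  assumes K: "K i \<ge> 1" and L: "\<And>k. k \<in> {1..K i} \<Longrightarrow> L_smooth n L (F i k)"
  shows "L_smooth n L (avg K F i)"
proof -
  have G: "has_gradient n (avg K F i) x ((1 / real (K i)) *\<^sub>R (\<Sum>k = 1..K i. grad n (F i k) x))"
    if "x \<in> Rn n" for x
    by (rule has_gradient_avg) (use that K L L_smooth_has_gradient in blast)+
  have "lipschitz_on L (Rn n) (grad n (avg K F i))"
  proof (rule lipschitz_onI)
    show "0 \<le> L" using L[of 1] K by (auto simp: L_smooth_def lipschitz_on_def)
    fix x y assume xy: "x \<in> Rn n" "y \<in> Rn n"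
    have "dist (grad n (avg K F i) x) (grad n (avg K F i) y)
      = 1 / real (K i) * norm (\<Sum>k = 1..K i. grad n (F i k) x - grad n (F i k) y)"
      using xy by (simp add: grad_eqI[OF G] dist_norm sum_subtractf flip: scaleR_diff_right)
    also have "\<dots> \<le> 1 / real (K i) * (\<Sum>k = 1..K i. L * dist x y)"
      using xy L by (intro mult_left_mono sum_norm_le)
        (auto simp: L_smooth_def lipschitz_on_def simp flip: dist_norm)
    also have "\<dots> = L * dist x y" using K by simp
    finally show "dist (grad n (avg K F i) x) (grad n (avg K F i) y) \<le> L * dist x y" .
  qed
  with G show ?thesis unfolding L_smooth_def by blast
qed

subsection \<open>The proximal operator\<close>

lemma power2_norm_diff_scaleR:
  fixes a b :: "'a :: real_inner"
  shows "(norm (a - u *\<^sub>R b))\<^sup>2 = (norm a)\<^sup>2 - (2 * u * inner a b - u\<^sup>2 * (norm b)\<^sup>2)"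
  unfolding power2_norm_eq_inner
  by (simp add: inner_diff_left inner_diff_right inner_commute power2_eq_square algebra_simps)

lemma epi_convex_comb:
  assumes "convex (epi n h)" "x \<in> Rn n" "y \<in> Rn n" "h x \<le> ereal r" "h y \<le> ereal s" "0 \<le> u" "u \<le> 1"
  shows "h (x + u *\<^sub>R (y - x)) \<le> ereal (r + u * (s - r))"
proof -
  have "(1 - u) *\<^sub>R (x, r) + u *\<^sub>R (y, s) \<in> epi n h"
    by (rule convexD[OF assms(1)]) (use assms in \<open>auto simp: epi_def\<close>)
  then show ?thesis by (simp add: epi_def algebra_simps)
qed

text \<open>At a point where \<open>h\<close> is not infinite, the subgradient inequality would fail
  if \<open>h z\<close> were infinite.\<close>

lemma subgradient_imp_finite:
  assumes "proper_closed_convex n h" "z \<in> Rn n" "v \<in> subdifferential n h z"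
  shows "\<bar>h z\<bar> \<noteq> \<infinity>"
proof -
  obtain x where x: "x \<in> Rn n" "h x \<noteq> \<infinity>"
    using assms(1) by (auto simp: proper_closed_convex_def proper_def)
  then have "h z + ereal (inner v (x - z)) \<le> h x"
    using assms(3) by (auto simp: subdifferential_def)
  then have "h z \<noteq> \<infinity>" using x by auto
  moreover have "h z \<noteq> -\<infinity>"
    using assms(1,2) by (auto simp: proper_closed_convex_def proper_def)
  ultimately show ?thesis by auto
qed

text \<open>A subgradient of \<open>h\<close> at any point yields an affine minorant, so the objective is bounded
  below; by strong convexity its minimizing sequences are Cauchy.\<close>

lemma prox_objective_attained:
  assumes h: "proper_closed_convex n h" and z: "z \<in> Rn n" "v \<in> subdifferential n h z" and "\<gamma> > 0" and y: "y \<in> Rn n"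
  shows "\<exists>a\<in>Rn n. \<forall>x\<in>Rn n. h a + ereal (1 / (2 * \<gamma>) * (norm (y - a))\<^sup>2)
    \<le> h x + ereal (1 / (2 * \<gamma>) * (norm (y - x))\<^sup>2)"
proof -
  define q where "q x = 1 / (2 * \<gamma>) * (norm (y - x))\<^sup>2" for x
  \<comment> \<open>Minimizing over the epigraph replaces the extended-valued objective by a
    real-valued one, so the infimum is an ordinary real number.\<close>
  define \<phi> where "\<phi> p = snd p + q (fst p)" for p :: "rvec \<times> real"
  define m where "m = Inf (\<phi> ` epi n h)"
  have clo: "closed (epi n h)" and con: "convex (epi n h)"
    and nminf: "\<And>x. x \<in> Rn n \<Longrightarrow> h x \<noteq> -\<infinity>"
    using h by (auto simp: proper_closed_convex_def proper_def)
  obtain c where c: "h z = ereal c"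
    using subgradient_imp_finite[OF h z] by auto
  have low: "c + inner v (y - z) - \<gamma> / 2 * (norm v)\<^sup>2 \<le> \<phi> p" if "p \<in> epi n h" for p
  proof -
    obtain x r where p: "p = (x, r)" by (cases p)
    have "h z + ereal (inner v (x - z)) \<le> h x" "h x \<le> ereal r"
      using that z by (auto simp: p epi_def subdifferential_def)
    then have lin: "c + inner v (x - z) \<le> r"
      using c by (metis order_trans plus_ereal.simps(1) ereal_less_eq(3))
    \<comment> \<open>Completing the square: the quadratic term dominates the affine minorant up to
      a constant.\<close>
    have "0 \<le> (norm (v - (1 / \<gamma>) *\<^sub>R (y - x)))\<^sup>2" by simp
    then have "0 \<le> (norm (y - x))\<^sup>2 / \<gamma>\<^sup>2 - 2 * inner v (y - x) / \<gamma> + (norm v)\<^sup>2"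
      unfolding power2_norm_diff_scaleR by (simp add: power_divide)
    then have "0 \<le> \<gamma> / 2 * ((norm (y - x))\<^sup>2 / \<gamma>\<^sup>2 - 2 * inner v (y - x) / \<gamma> + (norm v)\<^sup>2)"
      using \<open>\<gamma> > 0\<close> by simp
    also have "\<dots> = q x - inner v (y - x) + \<gamma> / 2 * (norm v)\<^sup>2"
      using \<open>\<gamma> > 0\<close> by (simp add: q_def field_simps power2_eq_square)
    finally show ?thesis using lin by (simp add: \<phi>_def p inner_diff_right)
  qed
  have bdd: "bdd_below (\<phi> ` epi n h)"
    using low by (rule bdd_belowI2)
  have m_le: "m \<le> \<phi> p" if "p \<in> epi n h" for p
    unfolding m_def using that bdd by (simp add: cInf_lower)
  have "(z, c) \<in> epi n h" using z c by (simp add: epi_def)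
  then have ne: "\<phi> ` epi n h \<noteq> {}" by blast
  have "\<exists>p\<in>epi n h. \<phi> p < m + 1 / real (Suc k)" for k
    using cInf_lessD[OF ne, of "m + 1 / real (Suc k)"] by (auto simp: m_def)
  then obtain P where P: "P k \<in> epi n h" "\<phi> (P k) < m + 1 / real (Suc k)" for k
    by metis
  define a r where "a k = fst (P k)" and "r k = snd (P k)" for k
  have aRn: "a k \<in> Rn n" and hr: "h (a k) \<le> ereal (r k)" for k
    using P(1)[of k] by (auto simp: a_def r_def epi_def split: prod.splits)
  \<comment> \<open>The midpoint of two near-minimizers is again in the epigraph, so its objective
    is at least \<open>m\<close>; by the parallelogram law it lies below the average of the two by a
    multiple of their squared distance.\<close>
  have gap: "(norm (a k - a l))\<^sup>2 \<le> 4 * \<gamma> * (1 / real (Suc k) + 1 / real (Suc l))" for k l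
  proof -
    let ?b = "a k + (1 / 2) *\<^sub>R (a l - a k)"
    have "(?b, r k + 1 / 2 * (r l - r k)) \<in> epi n h"
      using epi_convex_comb[OF con aRn aRn hr hr, of "1/2" k l] aRn[of k] aRn[of l]
      by (auto simp: epi_def intro!: Rn_closed_intros)
    then have "m \<le> r k + 1 / 2 * (r l - r k) + q ?b"
      using m_le by (force simp: \<phi>_def)
    moreover have "q ?b = (q (a k) + q (a l)) / 2 - (norm (a k - a l))\<^sup>2 / (8 * \<gamma>)"
    proof -
      have mid: "(norm (y - ?b))\<^sup>2
        = ((norm (y - a k))\<^sup>2 + (norm (y - a l))\<^sup>2) / 2 - (norm (a k - a l))\<^sup>2 / 4"
        unfolding power2_norm_eq_inner
        by (simp add: algebra_simps inner_diff_left inner_diff_right inner_add_left inner_add_right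
            inner_commute) (simp add: add_divide_distrib diff_divide_distrib)
      show ?thesis unfolding q_def mid using \<open>\<gamma> > 0\<close> by (simp add: field_simps)
    qed
    moreover have "r k + q (a k) < m + 1 / real (Suc k)" "r l + q (a l) < m + 1 / real (Suc l)"
      using P(2)[of k] P(2)[of l] by (simp_all add: \<phi>_def a_def r_def)
    ultimately have "(norm (a k - a l))\<^sup>2 / (8 * \<gamma>) \<le> (1 / real (Suc k) + 1 / real (Suc l)) / 2"
      by argo
    then show ?thesis using \<open>\<gamma> > 0\<close> by (simp add: pos_divide_le_eq mult_ac)
  qed
  have "Cauchy a"
  proof (rule CauchyI)
    fix e :: real assume "e > 0"
    then have "0 < e\<^sup>2 / (8 * \<gamma>)" using \<open>\<gamma> > 0\<close> by simp
    then obtain M where M: "1 / real (Suc M) < e\<^sup>2 / (8 * \<gamma>)"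
      using reals_Archimedean by (auto simp: inverse_eq_divide)
    have "norm (a k - a l) < e" if "k \<ge> M" "l \<ge> M" for k l
    proof -
      have "1 / real (Suc k) \<le> 1 / real (Suc M)" "1 / real (Suc l) \<le> 1 / real (Suc M)"
        using that by (auto simp: frac_le)
      then have "1 / real (Suc k) + 1 / real (Suc l) < 2 * (e\<^sup>2 / (8 * \<gamma>))"
        using M by linarith
      then have "4 * \<gamma> * (1 / real (Suc k) + 1 / real (Suc l)) < 4 * \<gamma> * (2 * (e\<^sup>2 / (8 * \<gamma>)))"
        using \<open>\<gamma> > 0\<close> by (intro mult_strict_left_mono) auto
      then have "(norm (a k - a l))\<^sup>2 < e\<^sup>2"
        using gap[of k l] \<open>\<gamma> > 0\<close> by simp
      then show ?thesis using \<open>e > 0\<close> power_less_imp_less_base by fastforce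
    qed
    then show "\<exists>M. \<forall>k\<ge>M. \<forall>l\<ge>M. norm (a k - a l) < e" by blast
  qed
  then obtain b where b: "b \<in> Rn n" "a \<longlonglongrightarrow> b"
    using complete_Rn[of n] aRn unfolding complete_def by metis
  have qlim: "(\<lambda>k. q (a k)) \<longlonglongrightarrow> q b"
    unfolding q_def by (intro tendsto_intros b)
  have "(\<lambda>k. \<phi> (P k)) \<longlonglongrightarrow> m"
  proof (rule tendsto_sandwich[of "\<lambda>_. m" _ _ "\<lambda>k. m + 1 / real (Suc k)"])
    show "(\<lambda>k. m + 1 / real (Suc k)) \<longlonglongrightarrow> m"
      using tendsto_add[OF tendsto_const[of m] LIMSEQ_Suc[OF lim_1_over_n]] by simp
  qed (use P m_le in \<open>auto intro!: always_eventually less_imp_le\<close>)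
  \<comment> \<open>Removing the continuous part \<open>q\<close> yields convergence of the heights
    \<open>r k\<close>, so closedness of the epigraph applies to the pairs.\<close>
  then have "(\<lambda>k. \<phi> (P k) - q (a k)) \<longlonglongrightarrow> m - q b"
    by (intro tendsto_diff qlim)
  then have "(\<lambda>k. (a k, r k)) \<longlonglongrightarrow> (b, m - q b)"
    by (intro tendsto_Pair b) (simp add: \<phi>_def a_def r_def)
  then have "(b, m - q b) \<in> epi n h"
    using closed_sequentially[OF clo, of "\<lambda>k. (a k, r k)"] P(1) by (simp add: a_def r_def)
  then have hb: "h b \<le> ereal (m - q b)" by (simp add: epi_def)
  have "h b + ereal (q b) \<le> h x + ereal (q x)" if x: "x \<in> Rn n" for x
  proof (cases "h x")
    case (real s)
    then have "m \<le> s + q x" using m_le[of "(x, s)"] x by (simp add: epi_def \<phi>_def)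
    have "h b + ereal (q b) \<le> ereal (m - q b) + ereal (q b)" using hb by (rule add_right_mono)
    also have "\<dots> \<le> h x + ereal (q x)" using real \<open>m \<le> s + q x\<close> by simp
    finally show ?thesis .
  qed (use nminf[OF x] in auto)
  with b show ?thesis unfolding q_def by blast
qed

lemma nonneg_of_affine_nonneg:
  fixes a b :: real
  assumes "\<And>u. 0 < u \<Longrightarrow> u \<le> 1 \<Longrightarrow> 0 \<le> a + u * b"
  shows "0 \<le> a"
proof (rule ccontr)
  assume a: "\<not> 0 \<le> a"
  \<comment> \<open>Small enough that \<open>u * (1 + \<bar>b\<bar>)\<close> is at most
    \<open>- a / 2\<close>; adding 1 to the absolute value keeps the denominator positive.\<close>
  define u where "u = min 1 (- a / (2 * (1 + \<bar>b\<bar>)))"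
  have u: "0 < u" "u \<le> 1" "u \<le> - a / (2 * (1 + \<bar>b\<bar>))"
    unfolding u_def using a by (auto intro!: divide_neg_pos)
  have "u * b \<le> u * (1 + \<bar>b\<bar>)" using u by (intro mult_left_mono) auto
  moreover have "u * (2 * (1 + \<bar>b\<bar>)) \<le> - a"
    using u(3) by (subst (asm) pos_le_divide_eq) auto
  then have "u * (1 + \<bar>b\<bar>) \<le> - a / 2" by (simp add: algebra_simps)
  ultimately show False using assms[OF u(1,2)] a by simp
qed

text \<open>First-order optimality: compare the minimizer \<open>p\<close> with
  \<open>p + u *\<^sub>R (x - p)\<close>, divide by \<open>u\<close> and let \<open>u\<close> tend
  to 0. The subgradient at \<open>z\<close> secures existence of a minimizer, without which the
  choice in \<open>arg_min\<close> carries no information.\<close>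

lemma prox_subgradient:
  assumes h: "proper_closed_convex n h" and z: "z \<in> Rn n" "v \<in> subdifferential n h z"
    and "\<gamma> > 0" and y: "y \<in> Rn n"
  shows "prox n \<gamma> h y \<in> Rn n"
    and "(1 / \<gamma>) *\<^sub>R (y - prox n \<gamma> h y) \<in> subdifferential n h (prox n \<gamma> h y)"
proof -
  define p where "p = prox n \<gamma> h y"
  let ?obj = "\<lambda>x. h x + ereal (1 / (2 * \<gamma>) * (norm (y - x))\<^sup>2)"
  have "\<exists>a. is_arg_min ?obj (\<lambda>x. x \<in> Rn n) a"
    using prox_objective_attained[OF assms] unfolding is_arg_min_linorder by blast
  then have "is_arg_min ?obj (\<lambda>x. x \<in> Rn n) p"
    unfolding p_def prox_def arg_min_def by (rule someI_ex)
  then have p: "p \<in> Rn n" and min: "\<And>x. x \<in> Rn n \<Longrightarrow> ?obj p \<le> ?obj x"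
    by (auto simp: is_arg_min_linorder)
  have con: "convex (epi n h)" and nminf: "\<And>x. x \<in> Rn n \<Longrightarrow> h x \<noteq> -\<infinity>"
    using h by (auto simp: proper_closed_convex_def proper_def)
  have "h z \<noteq> \<infinity>" using subgradient_imp_finite[OF h z] by auto
  then have "h p \<noteq> \<infinity>" using min[OF z(1)] by auto
  then obtain c where c: "h p = ereal c" using nminf[OF p] by (cases "h p") auto
  have "h p + ereal (inner ((1 / \<gamma>) *\<^sub>R (y - p)) (x - p)) \<le> h x" if x: "x \<in> Rn n" for x
  proof (cases "h x")
    case (real s)
    have "0 \<le> (s - c - inner (y - p) (x - p) / \<gamma>) + u * ((norm (x - p))\<^sup>2 / (2 * \<gamma>))"
      if u: "0 < u" "u \<le> 1" for u
    proof -
      let ?w = "p + u *\<^sub>R (x - p)"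
      have w: "?w \<in> Rn n" using p x by (intro Rn_closed_intros)
      have "?obj p \<le> ?obj ?w" by (rule min[OF w])
      also have "\<dots> \<le> ereal (c + u * (s - c)) + ereal (1 / (2 * \<gamma>) * (norm (y - ?w))\<^sup>2)"
        by (intro add_right_mono epi_convex_comb[OF con p x]) (use c real u in auto)
      finally have "c + 1 / (2 * \<gamma>) * (norm (y - p))\<^sup>2
        \<le> c + u * (s - c) + 1 / (2 * \<gamma>) * (norm (y - ?w))\<^sup>2"
        using c by simp
      moreover have "y - ?w = (y - p) - u *\<^sub>R (x - p)" by simp
      ultimately have "0 \<le> u * (s - c)
        - 1 / (2 * \<gamma>) * (2 * u * inner (y - p) (x - p) - u\<^sup>2 * (norm (x - p))\<^sup>2)"
        by (simp only: power2_norm_diff_scaleR right_diff_distrib[of "1 / (2 * \<gamma>)"])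
      also have "\<dots> = u * ((s - c - inner (y - p) (x - p) / \<gamma>) + u * ((norm (x - p))\<^sup>2 / (2 * \<gamma>)))"
        using \<open>\<gamma> > 0\<close> by (simp add: field_simps power2_eq_square)
      finally show ?thesis using u by (simp add: zero_le_mult_iff)
    qed
    then have "0 \<le> s - c - inner (y - p) (x - p) / \<gamma>" by (rule nonneg_of_affine_nonneg)
    then show ?thesis using c real by simp
  qed (use nminf[OF x] in auto)
  then show "prox n \<gamma> h y \<in> Rn n"
    and "(1 / \<gamma>) *\<^sub>R (y - prox n \<gamma> h y) \<in> subdifferential n h (prox n \<gamma> h y)"
    using p y unfolding p_def[symmetric] subdifferential_def by (auto intro!: Rn_closed_intros)
qed

subsection \<open>Networks\<close>

text \<open>Polarize \<open>inner (X - Y) Y\<close>, write \<open>- inner G Y\<close> as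
  \<open>- inner G X\<close> plus \<open>inner G (X - Y)\<close>, and complete the square. Dropping
  the last square is the use of Young's inequality.\<close>

lemma proximal_gradient_identity:
  fixes X Y G :: "'a :: real_inner" and e :: real
  assumes "e > 0"
  shows "inner ((1 / e) *\<^sub>R (X - Y) - G) Y
    = 1 / (2 * e) * (norm X)\<^sup>2 - 1 / (2 * e) * (norm Y)\<^sup>2 - inner G X + e / 2 * (norm G)\<^sup>2
      - 1 / (2 * e) * (norm (X - Y - e *\<^sub>R G))\<^sup>2"
proof -
  have sq: "(norm (X - Y - e *\<^sub>R G))\<^sup>2
    = (norm X)\<^sup>2 + (norm Y)\<^sup>2 - 2 * inner X Y - 2 * e * (inner G X - inner G Y) + e\<^sup>2 * (norm G)\<^sup>2"
    unfolding power2_norm_diff_scaleR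
    by (simp add: power2_norm_eq_inner inner_diff_left inner_diff_right inner_commute algebra_simps)
  have lhs: "inner ((1 / e) *\<^sub>R (X - Y) - G) Y = (inner X Y - (norm Y)\<^sup>2) / e - inner G Y"
    by (simp add: inner_diff_left power2_norm_eq_inner)
  show ?thesis
    unfolding sq lhs using assms by (simp add: power2_eq_square field_simps)
qed

section \<open>Neighbours and edge counting\<close>

lemma connected_graph_edge:
  "connected_graph V E \<Longrightarrow> e \<in> E \<Longrightarrow> \<exists>i\<in>V. \<exists>j\<in>V. i \<noteq> j \<and> e = {i, j}"
  unfolding connected_graph_def by (elim conjE) (rule bspec)

lemma nbrs_connected_graph:
  assumes "connected_graph V E" "j \<in> nbrs E i"
  shows "j \<in> V" "i \<in> nbrs E j"
proof -
  have "{i, j} \<in> E" using assms(2) by (simp add: nbrs_def)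
  from connected_graph_edge[OF assms(1) this] show "j \<in> V" by (auto simp: doubleton_eq_iff)
  show "i \<in> nbrs E j" using \<open>{i, j} \<in> E\<close> by (simp add: nbrs_def insert_commute)
qed

lemma finite_nodes: "connected_graph V E \<Longrightarrow> finite V"
  by (simp add: connected_graph_def)

lemma finite_nbrs:
  assumes "connected_graph V E"
  shows "finite (nbrs E i)"
proof (rule finite_subset)
  show "nbrs E i \<subseteq> V" using nbrs_connected_graph(1)[OF assms] by blast
qed (rule finite_nodes[OF assms])

lemma finite_edges:
  assumes "connected_graph V E"
  shows "finite E"
proof (rule finite_subset)
  show "E \<subseteq> Pow V"
  proof
    fix e assume "e \<in> E"
    from connected_graph_edge[OF assms this] show "e \<in> Pow V" by blast
  qed
qed (simp add: finite_nodes[OF assms])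

text \<open>Adjacency is symmetric, so swapping is a bijection of the ordered pairs of
  neighbours.\<close>

lemma sum_nbrs_swap:
  fixes G :: "'v \<Rightarrow> 'v \<Rightarrow> 'a :: comm_monoid_add"
  assumes "connected_graph V E"
  shows "(\<Sum>i\<in>V. \<Sum>j\<in>nbrs E i. G j i) = (\<Sum>i\<in>V. \<Sum>j\<in>nbrs E i. G i j)"
proof -
  have fin: "finite V" "\<forall>i\<in>V. finite (nbrs E i)"
    using finite_nbrs[OF assms] finite_nodes[OF assms] by simp_all
  have "(\<Sum>(i, j)\<in>Sigma V (nbrs E). G j i) = (\<Sum>(i, j)\<in>Sigma V (nbrs E). G i j)"
    by (rule sum.reindex_bij_witness[of _ prod.swap prod.swap])
      (auto dest: nbrs_connected_graph[OF assms])
  then show ?thesis using fin by (simp add: sum.Sigma)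
qed

text \<open>Handshake argument: an edge arises from at most two ordered pairs.\<close>

lemma sum_card_nbrs_le:
  assumes "connected_graph V E"
  shows "(\<Sum>i\<in>V. card (nbrs E i)) \<le> 2 * card E"
proof -
  have fin: "finite V" "\<forall>i\<in>V. finite (nbrs E i)"
    using finite_nbrs[OF assms] finite_nodes[OF assms] by simp_all
  have fib: "finite {(a, b). {a, b} = e} \<and> card {(a, b). {a, b} = e} \<le> 2" if e: "e \<in> E" for e
  proof -
    obtain i j where "e = {i, j}"
      using connected_graph_edge[OF assms e] by blast
    then have sub: "{(a, b). {a, b} = e} \<subseteq> set [(i, j), (j, i)]"
      by (auto simp: doubleton_eq_iff)
    have "card {(a, b). {a, b} = e} \<le> length [(i, j), (j, i)]"
      using card_mono[OF _ sub] card_length[of "[(i, j), (j, i)]"] by (meson List.finite_set le_trans)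
    with sub show ?thesis by (auto intro: finite_subset)
  qed
  have "(\<Sum>i\<in>V. card (nbrs E i)) = card (Sigma V (nbrs E))"
    using fin by (simp add: card_SigmaI)
  also have "\<dots> \<le> card (\<Union>e\<in>E. {(a, b). {a, b} = e})"
    using finite_edges[OF assms] fib by (intro card_mono) (auto simp: nbrs_def)
  also have "\<dots> \<le> (\<Sum>e\<in>E. card {(a, b). {a, b} = e})"
    by (rule card_UN_le[OF finite_edges[OF assms]])
  also have "\<dots> \<le> (\<Sum>e\<in>E. 2)"
    using fib by (intro sum_mono) simp
  finally show ?thesis by simp
qed

subsection \<open>One iteration\<close>

locale skpd_problem =
  fixes V :: "'v set" and E :: "'v set set" and n :: nat and L \<rho> :: real
    and f :: "'v \<Rightarrow> rvec \<Rightarrow> real" and h :: "'v \<Rightarrow> rvec \<Rightarrow> ereal" and \<eta> :: "'v \<Rightarrow> real"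
    and xs :: "'v \<Rightarrow> rvec" and ls :: "'v \<Rightarrow> 'v \<Rightarrow> rvec" and vs :: "'v \<Rightarrow> rvec"
  assumes \<rho>_pos: "\<rho> > 0" and n_pos: "n \<ge> 1" and L_pos: "L > 0"
    and graph: "connected_graph V E"
    and smooth: "\<And>i. i \<in> V \<Longrightarrow> L_smooth n L (f i)"
    and convex_f: "\<And>i. i \<in> V \<Longrightarrow> convex_on (Rn n) (f i)"
    and pcc: "\<And>i. i \<in> V \<Longrightarrow> proper_closed_convex n (h i)"
    and kkt: "kkt_point V E n f h xs ls vs"
    and \<eta>: "\<And>i. i \<in> V \<Longrightarrow> \<eta> i = 1 / (8 * real n * L)"
begin

section \<open>The energy and its ingredients\<close>

definition gs :: "'v \<Rightarrow> rvec" where "gs i = grad n (f i) (xs i)"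

definition feasible :: "'v skpd_state \<Rightarrow> bool"
  where "feasible s \<longleftrightarrow> (\<forall>i\<in>V. primal s i \<in> Rn n \<and> memory s i \<in> Rn n \<and> (\<forall>j\<in>nbrs E i. dual s i j \<in> Rn n))"

definition Df :: "'v skpd_state \<Rightarrow> 'v \<Rightarrow> real"
  where "Df s i = bregman_smooth n (f i) (primal s i) (xs i)"

text \<open>\<open>real_of_ereal\<close> sends an infinite divergence to 0, so this is the true
  divergence only at states where \<open>h i\<close> is finite. Proximal steps always lead to such
  states; the initial state needs its divergence bound.\<close>

definition Dh :: "'v skpd_state \<Rightarrow> 'v \<Rightarrow> real"
  where "Dh s i = real_of_ereal (bregman_subgrad (h i) (vs i) (primal s i) (xs i))"

definition edge_energy :: "'v skpd_state \<Rightarrow> real"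
  where "edge_energy s = 1 / (4 * \<rho>) *
    (\<Sum>i\<in>V. \<Sum>j\<in>nbrs E i. (norm (dual s i j - ls i j - \<rho> *\<^sub>R (primal s i - xs i)))\<^sup>2)"

text \<open>With \<open>\<eta> = 1 / (8 * n * L)\<close> the two node weights are
  \<open>1 / (2 * \<eta>)\<close> and \<open>\<eta> * n\<^sup>2\<close>.\<close>

definition energy :: "'v skpd_state \<Rightarrow> real"
  where "energy s = (\<Sum>i\<in>V. 4 * real n * L * (norm (primal s i - xs i))\<^sup>2
      + real n / (8 * L) * (norm (memory s i - gs i))\<^sup>2) + edge_energy s"

definition sketch :: "'v skpd_state \<Rightarrow> 'v \<Rightarrow> nat \<Rightarrow> rvec"
  where "sketch s i j = unit_vector j \<odot> (grad n (f i) (primal s i) - memory s i)"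

definition sketched_grad :: "'v skpd_state \<Rightarrow> 'v \<Rightarrow> nat \<Rightarrow> rvec"
  where "sketched_grad s i j = memory s i + real n *\<^sub>R sketch s i j"

text \<open>Collects the sample-dependent terms of the one-step bound: the linear term, the squared
  gradient error with factor \<open>\<eta> / 2\<close>, and the energy of the updated
  memory.\<close>

definition noise :: "'v skpd_state \<Rightarrow> 'v \<Rightarrow> nat \<Rightarrow> real"
  where "noise s i j = - inner (sketched_grad s i j - gs i) (primal s i - xs i)
    + 1 / (16 * real n * L) * (norm (sketched_grad s i j - gs i))\<^sup>2
    + real n / (8 * L) * (norm (memory s i + sketch s i j - gs i))\<^sup>2"

definition iterate :: "('v \<Rightarrow> nat) \<Rightarrow> 'v skpd_state \<Rightarrow> 'v skpd_state"
  where "iterate = skpd_step E n \<rho> \<eta> f h"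

section \<open>KKT data and well-definedness of the iterates\<close>

lemma xs_Rn: "i \<in> V \<Longrightarrow> xs i \<in> Rn n"
  and vs_sub: "i \<in> V \<Longrightarrow> vs i \<in> subdifferential n (h i) (xs i)"
  and xs_consensus: "i \<in> V \<Longrightarrow> j \<in> nbrs E i \<Longrightarrow> xs i = xs j"
  and ls_anti: "i \<in> V \<Longrightarrow> j \<in> nbrs E i \<Longrightarrow> ls i j + ls j i = 0"
  and kkt_stationary: "i \<in> V \<Longrightarrow> vs i + gs i + (\<Sum>j\<in>nbrs E i. ls j i) = 0"
  using kkt unfolding kkt_point_def gs_def by blast+

lemma gs_Rn: "i \<in> V \<Longrightarrow> gs i \<in> Rn n"
  unfolding gs_def using smooth xs_Rn L_smooth_grad_Rn by blast

lemma finite_V: "finite V"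
  by (rule finite_nodes[OF graph])

lemma feasibleD:
  assumes "feasible s" "i \<in> V"
  shows "primal s i \<in> Rn n" "memory s i \<in> Rn n" "\<And>j. j \<in> nbrs E i \<Longrightarrow> dual s i j \<in> Rn n"
    "\<And>j. j \<in> nbrs E i \<Longrightarrow> primal s j \<in> Rn n" "\<And>j. j \<in> nbrs E i \<Longrightarrow> dual s j i \<in> Rn n"
    "grad n (f i) (primal s i) \<in> Rn n"
proof -
  have all: "primal s k \<in> Rn n" "memory s k \<in> Rn n" "l \<in> nbrs E k \<Longrightarrow> dual s k l \<in> Rn n" if "k \<in> V" for k l
    using assms(1) that unfolding feasible_def by simp_all
  note this[OF assms(2)]
  then show "primal s i \<in> Rn n" "memory s i \<in> Rn n" "\<And>j. j \<in> nbrs E i \<Longrightarrow> dual s i j \<in> Rn n"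
    by simp_all
  then show "grad n (f i) (primal s i) \<in> Rn n"
    using L_smooth_grad_Rn[OF smooth[OF assms(2)]] by blast
  fix j assume j: "j \<in> nbrs E i"
  show "primal s j \<in> Rn n" "dual s j i \<in> Rn n"
    using all nbrs_connected_graph[OF graph j] by simp_all
qed

lemma sketch_Rn: "feasible s \<Longrightarrow> i \<in> V \<Longrightarrow> sketch s i j \<in> Rn n"
  unfolding sketch_def
  by (intro unit_vector_entrywise_Rn Rn_closed_intros feasibleD)

lemma sketched_grad_Rn: "feasible s \<Longrightarrow> i \<in> V \<Longrightarrow> sketched_grad s i j \<in> Rn n"
  unfolding sketched_grad_def by (intro Rn_closed_intros feasibleD sketch_Rn)

lemma memory_iterate: "memory (iterate J s) i = memory s i + sketch s i (J i)"
  by (simp add: iterate_def skpd_step_def Let_def sketch_def)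

lemma dual_iterate: "dual (iterate J s) i j = - dual s j i + \<rho> *\<^sub>R (primal s j - primal (iterate J s) i)"
  by (simp add: iterate_def skpd_step_def Let_def)

text \<open>Optimality of the proximal step, restated with the new duals. Since
  \<open>1 / \<gamma>\<close> is \<open>1 / \<eta> i\<close> plus \<rho> times the degree, the
  degree part of the new iterate is absorbed by summing the dual update over the neighbours;
  \<open>8 * n * L\<close> is \<open>1 / \<eta> i\<close>.\<close>

lemma primal_iterate:
  assumes s: "feasible s" and i: "i \<in> V"
  shows "primal (iterate J s) i \<in> Rn n"
    and "(8 * real n * L) *\<^sub>R (primal s i - primal (iterate J s) i) - sketched_grad s i (J i)
        + (\<Sum>j\<in>nbrs E i. dual (iterate J s) i j)
      \<in> subdifferential n (h i) (primal (iterate J s) i)"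
proof -
  define c where "c = 8 * real n * L"
  define N where "N = real (card (nbrs E i))"
  define \<gamma> where "\<gamma> = inverse (1 / \<eta> i + \<rho> * N)"
  define q where "q = (\<Sum>j\<in>nbrs E i. \<rho> *\<^sub>R primal s j - dual s j i)"
  define y where "y = (\<gamma> / \<eta> i) *\<^sub>R (primal s i - \<eta> i *\<^sub>R sketched_grad s i (J i)) + \<gamma> *\<^sub>R q"
  let ?x = "primal (iterate J s) i"
  have c: "c > 0" "1 / \<eta> i = c" and \<eta>i: "\<eta> i \<noteq> 0"
    using n_pos L_pos by (simp_all add: c_def \<eta>[OF i])
  have "N \<ge> 0" by (simp add: N_def)
  then have "c + \<rho> * N > 0" using c \<rho>_pos by (simp add: add_pos_nonneg)
  then have \<gamma>: "\<gamma> > 0" "1 / \<gamma> = c + \<rho> * N" unfolding \<gamma>_def c(2) by (auto simp: inverse_eq_divide)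
  have p: "?x = prox n \<gamma> (h i) y"
    by (simp only: iterate_def skpd_step_def Let_def skpd_state.select_convs sketch_def sketched_grad_def
        y_def q_def \<gamma>_def N_def)
  have "q \<in> Rn n"
    unfolding q_def by (intro Rn_closed_intros feasibleD(4,5)[OF s i])
  then have y: "y \<in> Rn n"
    unfolding y_def by (intro Rn_closed_intros feasibleD(1)[OF s i] sketched_grad_Rn[OF s i])
  have P: "prox n \<gamma> (h i) y \<in> Rn n"
    "(1 / \<gamma>) *\<^sub>R (y - prox n \<gamma> (h i) y) \<in> subdifferential n (h i) (prox n \<gamma> (h i) y)"
    by (rule prox_subgradient[OF pcc[OF i] xs_Rn[OF i] vs_sub[OF i] \<gamma>(1) y])+
  then show "primal (iterate J s) i \<in> Rn n" using p by simp
  have "(1 / \<gamma>) *\<^sub>R y = (1 / \<eta> i) *\<^sub>R primal s i - sketched_grad s i (J i) + q"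
    using \<gamma>(1) \<eta>i by (simp add: y_def scaleR_add_right scaleR_diff_right)
  moreover have "(\<Sum>j\<in>nbrs E i. dual (iterate J s) i j) = q - (\<rho> * N) *\<^sub>R ?x"
  proof -
    have "dual (iterate J s) i j = (\<rho> *\<^sub>R primal s j - dual s j i) - \<rho> *\<^sub>R ?x" for j
      by (simp add: dual_iterate scaleR_diff_right)
    then have "(\<Sum>j\<in>nbrs E i. dual (iterate J s) i j) = q - (\<Sum>j\<in>nbrs E i. \<rho> *\<^sub>R ?x)"
      by (simp only: q_def sum_subtractf)
    then show ?thesis by (simp add: N_def sum_constant_scaleR mult.commute del: sum_constant)
  qed
  ultimately have "(1 / \<gamma>) *\<^sub>R (y - ?x) = c *\<^sub>R (primal s i - ?x) - sketched_grad s i (J i)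
      + (\<Sum>j\<in>nbrs E i. dual (iterate J s) i j)"
    unfolding c(2) \<gamma>(2) by (simp add: scaleR_diff_right scaleR_add_left)
  then show "(8 * real n * L) *\<^sub>R (primal s i - ?x) - sketched_grad s i (J i)
        + (\<Sum>j\<in>nbrs E i. dual (iterate J s) i j) \<in> subdifferential n (h i) ?x"
    using P(2) p by (simp add: c_def)
qed

lemma feasible_iterate:
  assumes "feasible s"
  shows "feasible (iterate J s)"
  unfolding feasible_def
proof (intro ballI conjI)
  fix i assume i: "i \<in> V"
  show "primal (iterate J s) i \<in> Rn n" by (rule primal_iterate(1)[OF assms i])
  then show "dual (iterate J s) i j \<in> Rn n" if "j \<in> nbrs E i" for j
    unfolding dual_iterate using feasibleD(4,5)[OF assms i that] by (intro Rn_closed_intros)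
  show "memory (iterate J s) i \<in> Rn n"
    unfolding memory_iterate by (intro Rn_closed_intros feasibleD[OF assms i] sketch_Rn[OF assms i])
qed

lemma h_finite_iterate:
  "feasible s \<Longrightarrow> i \<in> V \<Longrightarrow> \<bar>h i (primal (iterate J s) i)\<bar> \<noteq> \<infinity>"
  by (rule subgradient_imp_finite[OF pcc primal_iterate])

lemma Df_nonneg: "feasible s \<Longrightarrow> i \<in> V \<Longrightarrow> Df s i \<ge> 0"
  unfolding Df_def by (intro bregman_smooth_nonneg[OF smooth convex_f] feasibleD xs_Rn)

lemma bregman_subgrad_eq_Dh:
  assumes "i \<in> V" "\<bar>h i (primal s i)\<bar> \<noteq> \<infinity>"
  shows "bregman_subgrad (h i) (vs i) (primal s i) (xs i) = ereal (Dh s i)"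
    and "Dh s i = real_of_ereal (h i (primal s i)) - real_of_ereal (h i (xs i))
      - inner (vs i) (primal s i - xs i)"
proof -
  have "\<bar>h i (xs i)\<bar> \<noteq> \<infinity>"
    by (rule subgradient_imp_finite[OF pcc xs_Rn vs_sub]) (rule assms)+
  then obtain r c where "h i (primal s i) = ereal r" "h i (xs i) = ereal c"
    using assms(2) by auto
  then show "bregman_subgrad (h i) (vs i) (primal s i) (xs i) = ereal (Dh s i)"
    and "Dh s i = real_of_ereal (h i (primal s i)) - real_of_ereal (h i (xs i))
      - inner (vs i) (primal s i - xs i)"
    by (simp_all add: Dh_def bregman_subgrad_def)
qed

lemma Dh_nonneg:
  assumes "feasible s" "i \<in> V" "\<bar>h i (primal s i)\<bar> \<noteq> \<infinity>"
  shows "Dh s i \<ge> 0"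
proof -
  have "h i (xs i) + ereal (inner (vs i) (primal s i - xs i)) \<le> h i (primal s i)"
    using vs_sub[OF assms(2)] feasibleD(1)[OF assms(1,2)] by (auto simp: subdifferential_def)
  moreover have "\<bar>h i (xs i)\<bar> \<noteq> \<infinity>"
    by (rule subgradient_imp_finite[OF pcc xs_Rn vs_sub]) (rule assms)+
  ultimately show ?thesis
    using assms(3) unfolding bregman_subgrad_eq_Dh(2)[OF assms(2,3)] by auto
qed

section \<open>Decrease of the energy for given samples\<close>

lemma edge_energy_nonneg: "edge_energy s \<ge> 0"
  unfolding edge_energy_def using \<rho>_pos by (intro mult_nonneg_nonneg sum_nonneg) auto

lemma energy_nonneg: "energy s \<ge> 0"
  unfolding energy_def using edge_energy_nonneg L_pos by (intro add_nonneg_nonneg sum_nonneg) auto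

text \<open>The new iterate carries an explicit subgradient of \<open>h i\<close>; its inequality at
  \<open>xs i\<close> bounds the divergence by an inner product, which the proximal gradient
  identity with step \<open>1 / (8 * n * L)\<close> turns into a difference of squared distances
  plus sampled terms.\<close>

lemma node_descent:
  assumes s: "feasible s" and i: "i \<in> V"
  shows "Dh (iterate J s) i + 4 * real n * L * (norm (primal (iterate J s) i - xs i))\<^sup>2
      + real n / (8 * L) * (norm (memory (iterate J s) i - gs i))\<^sup>2
    \<le> 4 * real n * L * (norm (primal s i - xs i))\<^sup>2 + noise s i (J i)
      + (\<Sum>j\<in>nbrs E i. inner (dual (iterate J s) i j - ls i j) (primal (iterate J s) i - xs i))"
proof -
  let ?x = "primal (iterate J s) i" and ?c = "8 * real n * L"
  let ?X = "primal s i - xs i" and ?G = "sketched_grad s i (J i) - gs i"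
  let ?Y = "?x - xs i"
  let ?v = "?c *\<^sub>R (primal s i - ?x) - sketched_grad s i (J i) + (\<Sum>j\<in>nbrs E i. dual (iterate J s) i j)"
  have c: "?c > 0" using n_pos L_pos by simp
  have "h i ?x + ereal (inner ?v (xs i - ?x)) \<le> h i (xs i)"
    using primal_iterate(2)[OF s i, of J] xs_Rn[OF i] by (auto simp: subdifferential_def)
  moreover have "\<bar>h i (xs i)\<bar> \<noteq> \<infinity>"
    by (rule subgradient_imp_finite[OF pcc xs_Rn vs_sub]) (rule i)+
  moreover have "inner ?v (xs i - ?x) = - inner ?v ?Y"
    by (simp only: minus_diff_eq[symmetric, of "?x"] inner_minus_right)
  ultimately have "real_of_ereal (h i ?x) - real_of_ereal (h i (xs i)) \<le> inner ?v ?Y"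
    using h_finite_iterate[OF s i, of J]
    by (cases "h i ?x"; cases "h i (xs i)") (simp_all only: plus_ereal.simps ereal_less_eq real_of_ereal.simps, simp_all)
  then have "Dh (iterate J s) i \<le> inner (?v - vs i) ?Y"
    unfolding bregman_subgrad_eq_Dh(2)[OF i h_finite_iterate[OF s i]] by (simp add: inner_diff_left)
  \<comment> \<open>By stationarity and antisymmetry of the optimal multipliers,
    \<open>vs i + gs i\<close> is the sum of \<open>ls i j\<close>; subtracting \<open>vs i\<close>
    therefore centres the gradient and all duals at the solution.\<close>
  also have "?v - vs i = (?c *\<^sub>R (?X - ?Y) - ?G) + (\<Sum>j\<in>nbrs E i. dual (iterate J s) i j - ls i j)"
  proof -
    have "(\<Sum>j\<in>nbrs E i. ls i j) = - (\<Sum>j\<in>nbrs E i. ls j i)"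
      unfolding sum_negf[symmetric]
      by (rule sum.cong[OF refl], rule iffD2[OF eq_neg_iff_add_eq_0], rule ls_anti[OF i])
    also have "\<dots> = vs i + gs i"
      using kkt_stationary[OF i] by (simp add: neg_eq_iff_add_eq_0 ac_simps)
    finally show ?thesis by (simp add: sum_subtractf)
  qed
  also have "inner \<dots> ?Y = inner (?c *\<^sub>R (?X - ?Y) - ?G) ?Y
      + (\<Sum>j\<in>nbrs E i. inner (dual (iterate J s) i j - ls i j) ?Y)"
    by (simp only: inner_add_left inner_sum_left)
  also have "inner (?c *\<^sub>R (?X - ?Y) - ?G) ?Y
    \<le> ?c / 2 * (norm ?X)\<^sup>2 - ?c / 2 * (norm ?Y)\<^sup>2 - inner ?G ?X + 1 / (2 * ?c) * (norm ?G)\<^sup>2"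
    using proximal_gradient_identity[of "1 / ?c" ?X ?Y ?G] c by (simp add: mult.commute)
  finally show ?thesis
    by (simp add: noise_def memory_iterate mult_ac)
qed

text \<open>With \<open>a\<^sub>i\<^sub>j = \<lambda>\<^sub>i\<^sub>j - \<lambda>\<^sup>\<star>\<^sub>i\<^sub>j\<close> and \<open>X\<^sub>i = x\<^sub>i - x\<^sup>\<star>\<close>, the dual update reads
  \<open>a'\<^sub>i\<^sub>j + \<rho> X'\<^sub>i = - (a\<^sub>j\<^sub>i - \<rho> X\<^sub>j)\<close>, so polarization makes the sum telescope.\<close>

lemma edge_energy_iterate:
  assumes "feasible s"
  shows "(\<Sum>i\<in>V. \<Sum>j\<in>nbrs E i. inner (dual (iterate J s) i j - ls i j) (primal (iterate J s) i - xs i))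
    = edge_energy s - edge_energy (iterate J s)"
proof -
  let ?w = "\<lambda>s i j. (norm (dual s i j - ls i j - \<rho> *\<^sub>R (primal s i - xs i)))\<^sup>2"
  have "inner (dual (iterate J s) i j - ls i j) (primal (iterate J s) i - xs i)
      = 1 / (4 * \<rho>) * (?w s j i - ?w (iterate J s) i j)" if i: "i \<in> V" and j: "j \<in> nbrs E i" for i j
  proof -
    let ?a = "dual (iterate J s) i j - ls i j" and ?X = "primal (iterate J s) i - xs i"
    have "ls j i = - ls i j"
      using ls_anti[OF i j] by (simp add: eq_neg_iff_add_eq_0 add.commute)
    then have "dual s j i - ls j i - \<rho> *\<^sub>R (primal s j - xs j) = - (?a - (- \<rho>) *\<^sub>R ?X)"
      using xs_consensus[OF i j] by (simp add: dual_iterate algebra_simps)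
    then have "?w s j i = (norm (?a - (- \<rho>) *\<^sub>R ?X))\<^sup>2" by (simp only: norm_minus_cancel)
    then have "?w s j i - ?w (iterate J s) i j = 4 * \<rho> * inner ?a ?X"
      unfolding power2_norm_diff_scaleR by simp
    then show ?thesis using \<rho>_pos by simp
  qed
  then have "(\<Sum>i\<in>V. \<Sum>j\<in>nbrs E i. inner (dual (iterate J s) i j - ls i j) (primal (iterate J s) i - xs i))
    = (\<Sum>i\<in>V. \<Sum>j\<in>nbrs E i. 1 / (4 * \<rho>) * (?w s j i - ?w (iterate J s) i j))"
    by (intro sum.cong refl) blast
  also have "\<dots> = 1 / (4 * \<rho>) * ((\<Sum>i\<in>V. \<Sum>j\<in>nbrs E i. ?w s j i) - (\<Sum>i\<in>V. \<Sum>j\<in>nbrs E i. ?w (iterate J s) i j))"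
    by (simp only: sum_subtractf sum_distrib_left[symmetric])
  also have "(\<Sum>i\<in>V. \<Sum>j\<in>nbrs E i. ?w s j i) = (\<Sum>i\<in>V. \<Sum>j\<in>nbrs E i. ?w s i j)"
    by (rule sum_nbrs_swap[OF graph])
  finally show ?thesis by (simp only: edge_energy_def right_diff_distrib)
qed

lemma energy_iterate_le:
  assumes "feasible s"
  shows "energy (iterate J s) + (\<Sum>i\<in>V. Dh (iterate J s) i)
    \<le> (\<Sum>i\<in>V. 4 * real n * L * (norm (primal s i - xs i))\<^sup>2) + edge_energy s + (\<Sum>i\<in>V. noise s i (J i))"
  using sum_mono[of V, OF node_descent[OF assms], of "\<lambda>i. i" "\<lambda>_. J"] edge_energy_iterate[OF assms, of J]
  by (simp add: energy_def sum.distrib)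

text \<open>Average over the uniform coordinate. Unbiasedness of the sketch gives
  \<open>- inner d X\<close>; the squares leave the memory term with its weight in
  \<open>energy\<close>, as the contraction of the memory pays for the variance, and a multiple of
  \<open>D\<close> absorbed by cocoercivity.\<close>

lemma noise_average:
  assumes s: "feasible s" and i: "i \<in> V"
  shows "(\<Sum>j\<in>{1..n}. noise s i j) / real n \<le> real n / (8 * L) * (norm (memory s i - gs i))\<^sup>2 - Df s i"
proof -
  define d where "d = grad n (f i) (primal s i) - gs i"
  define m where "m = memory s i - gs i"
  define X where "X = primal s i - xs i"
  define \<nu> where "\<nu> = real n"
  define D where "D = (norm d)\<^sup>2"
  define M where "M = (norm m)\<^sup>2"
  define I where "I = inner m d"
  have \<nu>: "\<nu> \<ge> 1" using n_pos by (simp add: \<nu>_def)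
  have dm: "d - m \<in> Rn n"
    unfolding d_def m_def by (intro Rn_closed_intros feasibleD[OF s i] gs_Rn[OF i])
  have sk: "sketch s i j = unit_vector j \<odot> (d - m)" for j
    by (simp add: sketch_def d_def m_def)
  have S1: "(\<Sum>j\<in>{1..n}. inner z (sketch s i j)) = inner z (d - m)" for z
    by (simp only: inner_sum_right[symmetric] sk sum_unit_vector_entrywise[OF dm])
  have S2: "(\<Sum>j\<in>{1..n}. (norm (sketch s i j))\<^sup>2) = D + M - 2 * I"
    unfolding sk sum_norm_unit_vector_entrywise[OF dm]
    by (simp add: D_def M_def I_def power2_norm_eq_inner inner_diff_left inner_diff_right inner_commute)
  have sq: "(norm (m + c *\<^sub>R sketch s i j))\<^sup>2
      = M + 2 * c * inner m (sketch s i j) + c\<^sup>2 * (norm (sketch s i j))\<^sup>2" for c j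
    using power2_norm_diff_scaleR[of m "- c"] by (simp add: M_def)
  \<comment> \<open>Used with \<open>c = \<nu>\<close> for the sketched gradient and with
    \<open>c = 1\<close> for the updated memory.\<close>
  have SQ: "(\<Sum>j\<in>{1..n}. (norm (m + c *\<^sub>R sketch s i j))\<^sup>2)
      = \<nu> * M + 2 * c * (I - M) + c\<^sup>2 * (D + M - 2 * I)" for c
    unfolding sq sum.distrib sum_distrib_left[symmetric] S1 S2
    by (simp add: \<nu>_def I_def M_def inner_diff_right power2_norm_eq_inner)
  have "noise s i j = - inner X m - \<nu> * inner X (sketch s i j)
      + 1 / (16 * \<nu> * L) * (norm (m + \<nu> *\<^sub>R sketch s i j))\<^sup>2
      + \<nu> / (8 * L) * (norm (m + 1 *\<^sub>R sketch s i j))\<^sup>2" for j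
  proof -
    have e: "sketched_grad s i j - gs i = m + \<nu> *\<^sub>R sketch s i j"
      "memory s i + sketch s i j - gs i = m + 1 *\<^sub>R sketch s i j"
      by (simp_all add: m_def \<nu>_def sketched_grad_def)
    show ?thesis
      unfolding noise_def e by (simp add: X_def \<nu>_def inner_add_left inner_add_right inner_commute)
  qed
  then have "(\<Sum>j\<in>{1..n}. noise s i j) = - \<nu> * inner X m - \<nu> * inner X (d - m)
      + 1 / (16 * \<nu> * L) * (\<nu> * M + 2 * \<nu> * (I - M) + \<nu>\<^sup>2 * (D + M - 2 * I))
      + \<nu> / (8 * L) * (\<nu> * M + 2 * (I - M) + (D + M - 2 * I))"
    by (simp only: sum.distrib sum_subtractf sum_distrib_left[symmetric] S1 SQ) (simp add: \<nu>_def)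
  \<comment> \<open>An exact regrouping that isolates a subtracted remainder; the mixed term in it
    occurs only within \<open>D + M + 2 * I\<close>, the squared norm of \<open>m + d\<close>, so
    the remainder is nonnegative.\<close>
  also have "\<dots> = \<nu> * (- inner d X + (\<nu> / (8 * L) * M + 1 / (4 * L) * D)
      - 1 / (16 * \<nu> * L) * (2 * M + (\<nu> - 1) * (D + M + 2 * I) + D))"
  proof -
    define k where "k = 1 / (16 * \<nu> * L)"
    have k: "1 / (16 * \<nu> * L) = k" "\<nu> / (8 * L) = 2 * \<nu>\<^sup>2 * k" "1 / (4 * L) = 4 * \<nu> * k"
      using \<nu> L_pos by (simp_all add: k_def power2_eq_square)
    show ?thesis
      unfolding k by (simp add: inner_diff_right inner_commute algebra_simps power2_eq_square)
  qed
  finally have eq: "(\<Sum>j\<in>{1..n}. noise s i j) / real n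
      = - inner d X + (\<nu> / (8 * L) * M + 1 / (4 * L) * D)
        - 1 / (16 * \<nu> * L) * (2 * M + (\<nu> - 1) * (D + M + 2 * I) + D)"
    using \<nu> by (simp add: \<nu>_def)
  have "0 \<le> (norm (m + d))\<^sup>2" by simp
  also have "\<dots> = D + M + 2 * I"
    by (simp add: D_def M_def I_def power2_norm_eq_inner inner_add_left inner_add_right inner_commute)
  finally have "0 \<le> 1 / (16 * \<nu> * L) * (2 * M + (\<nu> - 1) * (D + M + 2 * I) + D)"
    using \<nu> L_pos by (auto simp: D_def M_def)
  moreover have "Df s i + D / (2 * L) \<le> inner d X"
    using grad_diff_inner_ge[OF smooth[OF i] convex_f[OF i] feasibleD(1)[OF s i] xs_Rn[OF i] L_pos]
    by (simp add: Df_def D_def d_def X_def gs_def)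
  \<comment> \<open>The step size enters here: \<open>2 * \<eta> * n\<close> is
    \<open>1 / (4 * L)\<close>, within the \<open>1 / (2 * L)\<close> granted by
    cocoercivity.\<close>
  moreover have "1 / (4 * L) * D \<le> D / (2 * L)"
    using L_pos by (simp add: D_def field_simps)
  ultimately show ?thesis
    unfolding eq by (simp add: M_def m_def \<nu>_def)
qed

end

subsection \<open>Expected energy along the iterations\<close>

text \<open>The noise is a sum of terms depending on one node's coordinate each, so its expectation
  is computed from the uniform marginals.\<close>

lemma expectation_sampling_component:
  fixes g :: "nat \<Rightarrow> real"
  assumes "finite V" "i \<in> V" "n \<ge> 1"
  shows "measure_pmf.expectation (sampling V n) (\<lambda>J. g (J i)) = (\<Sum>j\<in>{1..n}. g j) / real n"
proof -
  have "measure_pmf.expectation (sampling V n) (\<lambda>J. g (J i))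
    = measure_pmf.expectation (map_pmf (\<lambda>J. J i) (sampling V n)) g"
    by simp
  also have "map_pmf (\<lambda>J. J i) (sampling V n) = pmf_of_set {1..n}"
    unfolding sampling_def using assms by (simp add: Pi_pmf_component)
  also have "measure_pmf.expectation (pmf_of_set {1..n}) g = (\<Sum>j\<in>{1..n}. g j) / real n"
    using assms by (subst integral_pmf_of_set) auto
  finally show ?thesis .
qed

lemma finite_set_pmf_sampling:
  assumes "finite V" "n \<ge> 1"
  shows "finite (set_pmf (sampling V n))"
  unfolding sampling_def set_Pi_pmf[OF assms(1)]
  using assms by (intro finite_PiE_dflt) (auto simp: set_pmf_of_set)

text \<open>Iteration 1 is the initial state, so the recursion is stated from index
  \<open>Suc k\<close>, where \<open>t - 1\<close> does not truncate.\<close>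

lemma skpd_law_Suc:
  "skpd_law V E n \<rho> \<eta> f h s1 (Suc (Suc k)) =
    skpd_law V E n \<rho> \<eta> f h s1 (Suc k) \<bind>
      (\<lambda>s. sampling V n \<bind> (\<lambda>J. return_pmf (skpd_step E n \<rho> \<eta> f h J s)))"
  by (simp add: skpd_law_def)

context skpd_problem
begin

text \<open>One-step decrease in expectation. The gain \<open>Df\<close> is added on the left
  because subtraction of extended nonnegative reals truncates.\<close>

lemma sampled_energy_le:
  assumes s: "feasible s"
  shows "(\<integral>\<^sup>+ J. ennreal (energy (iterate J s) + (\<Sum>i\<in>V. Dh (iterate J s) i)) \<partial>measure_pmf (sampling V n))
    + ennreal (\<Sum>i\<in>V. Df s i) \<le> ennreal (energy s)"
proof -
  define B where "B = (\<Sum>i\<in>V. 4 * real n * L * (norm (primal s i - xs i))\<^sup>2) + edge_energy s"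
  define R where "R J = B + (\<Sum>i\<in>V. noise s i (J i))" for J
  have int: "integrable (measure_pmf (sampling V n)) g" for g :: "_ \<Rightarrow> real"
    by (rule integrable_measure_pmf_finite[OF finite_set_pmf_sampling[OF finite_V n_pos]])
  have le: "energy (iterate J s) + (\<Sum>i\<in>V. Dh (iterate J s) i) \<le> R J" for J
    unfolding R_def B_def by (rule energy_iterate_le[OF s])
  \<comment> \<open>\<open>R\<close> bounds a nonnegative quantity and is hence nonnegative itself,
    which allows passing from the nonnegative integral to the expectation.\<close>
  have "0 \<le> energy (iterate J s) + (\<Sum>i\<in>V. Dh (iterate J s) i)" for J
    by (intro add_nonneg_nonneg energy_nonneg sum_nonneg
        Dh_nonneg[OF feasible_iterate[OF s] _ h_finite_iterate[OF s]])
  then have R_nonneg: "0 \<le> R J" for J using le by (rule order_trans)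
  have "(\<integral>\<^sup>+ J. ennreal (energy (iterate J s) + (\<Sum>i\<in>V. Dh (iterate J s) i)) \<partial>measure_pmf (sampling V n))
    \<le> (\<integral>\<^sup>+ J. ennreal (R J) \<partial>measure_pmf (sampling V n))"
    by (intro nn_integral_mono ennreal_leI le)
  also have "\<dots> = ennreal (measure_pmf.expectation (sampling V n) R)"
    by (rule nn_integral_eq_integral[OF int]) (simp add: R_nonneg)
  also have "measure_pmf.expectation (sampling V n) R
    = B + (\<Sum>i\<in>V. (\<Sum>j\<in>{1..n}. noise s i j) / real n)"
  proof -
    have "measure_pmf.expectation (sampling V n) R
      = B + (\<Sum>i\<in>V. measure_pmf.expectation (sampling V n) (\<lambda>J. noise s i (J i)))"
      unfolding R_def by (simp add: Bochner_Integration.integral_add[OF int int] Bochner_Integration.integral_sum[OF int])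
    also have "\<dots> = B + (\<Sum>i\<in>V. (\<Sum>j\<in>{1..n}. noise s i j) / real n)"
      by (intro arg_cong2[where f = "(+)"] sum.cong refl expectation_sampling_component finite_V n_pos)
    finally show ?thesis .
  qed
  finally have 1: "(\<integral>\<^sup>+ J. ennreal (energy (iterate J s) + (\<Sum>i\<in>V. Dh (iterate J s) i)) \<partial>measure_pmf (sampling V n))
    \<le> ennreal (B + (\<Sum>i\<in>V. (\<Sum>j\<in>{1..n}. noise s i j) / real n))" (is "?I \<le> ennreal ?r") .
  have "0 \<le> measure_pmf.expectation (sampling V n) R"
    by (simp add: R_nonneg)
  then have r0: "0 \<le> ?r"
    unfolding \<open>measure_pmf.expectation (sampling V n) R = ?r\<close> .
  have "?r \<le> B + (\<Sum>i\<in>V. real n / (8 * L) * (norm (memory s i - gs i))\<^sup>2 - Df s i)"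
    by (intro add_left_mono sum_mono noise_average[OF s])
  also have "\<dots> = energy s - (\<Sum>i\<in>V. Df s i)"
    by (simp add: B_def energy_def sum.distrib sum_subtractf)
  finally have r1: "?r + (\<Sum>i\<in>V. Df s i) \<le> energy s" by simp
  have D0: "0 \<le> (\<Sum>i\<in>V. Df s i)" by (intro sum_nonneg Df_nonneg[OF s])
  have "?I + ennreal (\<Sum>i\<in>V. Df s i) \<le> ennreal ?r + ennreal (\<Sum>i\<in>V. Df s i)"
    by (rule add_right_mono[OF 1])
  also have "\<dots> = ennreal (?r + (\<Sum>i\<in>V. Df s i))" using r0 D0 by simp
  also have "\<dots> \<le> ennreal (energy s)" using r1 by (rule ennreal_leI)
  finally show ?thesis .
qed

section \<open>Telescoping over the iterations\<close>

definition finite_feasible :: "'v skpd_state \<Rightarrow> bool"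
  where "finite_feasible s \<longleftrightarrow> feasible s \<and> (\<forall>i\<in>V. \<bar>h i (primal s i)\<bar> \<noteq> \<infinity>)"

text \<open>The smooth and nonsmooth parts are separated because the energy pays for them at
  different iterations.\<close>

lemma expected_bregman_eq:
  assumes "\<And>s. s \<in> set_pmf p \<Longrightarrow> finite_feasible s"
  shows "expected_bregman V n f h xs vs p
    = (\<integral>\<^sup>+ s. ennreal (\<Sum>i\<in>V. Df s i) \<partial>measure_pmf p) + (\<integral>\<^sup>+ s. ennreal (\<Sum>i\<in>V. Dh s i) \<partial>measure_pmf p)"
proof -
  have "expected_bregman V n f h xs vs p
    = (\<integral>\<^sup>+ s. (\<Sum>i\<in>V. e2ennreal (bregman n (f i) (h i) (vs i) (primal s i) (xs i))) \<partial>measure_pmf p)"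
    unfolding expected_bregman_def by (subst nn_integral_sum) auto
  also have "\<dots> = (\<integral>\<^sup>+ s. ennreal (\<Sum>i\<in>V. Df s i) + ennreal (\<Sum>i\<in>V. Dh s i) \<partial>measure_pmf p)"
  proof (rule nn_integral_cong_AE, rule AE_pmfI)
    fix s assume "s \<in> set_pmf p"
    then have s: "feasible s" "\<And>i. i \<in> V \<Longrightarrow> \<bar>h i (primal s i)\<bar> \<noteq> \<infinity>"
      using assms by (auto simp: finite_feasible_def)
    have nn: "0 \<le> Df s i" "0 \<le> Dh s i" if "i \<in> V" for i
      using Df_nonneg[OF s(1) that] Dh_nonneg[OF s(1) that s(2)[OF that]] by auto
    have "(\<Sum>i\<in>V. e2ennreal (bregman n (f i) (h i) (vs i) (primal s i) (xs i)))
      = (\<Sum>i\<in>V. ennreal (Df s i + Dh s i))"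
      by (rule sum.cong[OF refl])
        (simp add: bregman_def bregman_subgrad_eq_Dh(1)[OF _ s(2)] Df_def[symmetric] e2ennreal_ereal)
    also have "\<dots> = ennreal (\<Sum>i\<in>V. Df s i + Dh s i)"
      by (rule sum_ennreal) (use nn in auto)
    also have "\<dots> = ennreal (\<Sum>i\<in>V. Df s i) + ennreal (\<Sum>i\<in>V. Dh s i)"
      using nn by (simp add: sum.distrib sum_nonneg)
    finally show "(\<Sum>i\<in>V. e2ennreal (bregman n (f i) (h i) (vs i) (primal s i) (xs i)))
      = ennreal (\<Sum>i\<in>V. Df s i) + ennreal (\<Sum>i\<in>V. Dh s i)" .
  qed
  also have "\<dots> = (\<integral>\<^sup>+ s. ennreal (\<Sum>i\<in>V. Df s i) \<partial>measure_pmf p) + (\<integral>\<^sup>+ s. ennreal (\<Sum>i\<in>V. Dh s i) \<partial>measure_pmf p)"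
    by (rule nn_integral_add) auto
  finally show ?thesis .
qed

lemma finite_feasible_skpd_law:
  assumes "finite_feasible s1" "s \<in> set_pmf (skpd_law V E n \<rho> \<eta> f h s1 (Suc k))"
  shows "finite_feasible s"
  using assms(2)
proof (induction k arbitrary: s)
  case 0
  then show ?case using assms(1) by (simp add: skpd_law_def)
next
  case (Suc k)
  from Suc.prems obtain s0 J where s0: "s0 \<in> set_pmf (skpd_law V E n \<rho> \<eta> f h s1 (Suc k))"
    and s: "s = iterate J s0"
    unfolding skpd_law_Suc iterate_def by auto
  have "feasible s0" using Suc.IH[OF s0] by (simp add: finite_feasible_def)
  then show ?case
    unfolding s finite_feasible_def by (intro conjI ballI feasible_iterate h_finite_iterate)
qed

text \<open>Each step pays for \<open>Df\<close> at the old and \<open>Dh\<close> at the new state,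
  so only \<open>Dh\<close> at the initial state remains to be added to the initial energy.\<close>

lemma sum_expected_bregman_le:
  assumes s1: "finite_feasible s1"
  shows "(\<Sum>t\<in>{1..T}. expected_bregman V n f h xs vs (skpd_law V E n \<rho> \<eta> f h s1 t))
    \<le> ennreal (energy s1 + (\<Sum>i\<in>V. Dh s1 i))"
proof -
  \<comment> \<open>\<open>P k\<close> is the law at iteration \<open>k + 1\<close>.\<close>
  define P where "P k = skpd_law V E n \<rho> \<eta> f h s1 (Suc k)" for k
  define A where "A k = (\<integral>\<^sup>+ s. ennreal (energy s) \<partial>measure_pmf (P k))" for k
  define F where "F k = (\<integral>\<^sup>+ s. ennreal (\<Sum>i\<in>V. Df s i) \<partial>measure_pmf (P k))" for k
  define H where "H k = (\<integral>\<^sup>+ s. ennreal (\<Sum>i\<in>V. Dh s i) \<partial>measure_pmf (P k))" for k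
  have fin: "finite_feasible s" if "s \<in> set_pmf (P k)" for s k
    using finite_feasible_skpd_law[OF s1] that by (simp add: P_def)
  have split: "expected_bregman V n f h xs vs (skpd_law V E n \<rho> \<eta> f h s1 (Suc k)) = F k + H k" for k
    unfolding F_def H_def P_def[symmetric] by (rule expected_bregman_eq) (rule fin)
  have Dh0: "0 \<le> (\<Sum>i\<in>V. Dh s i)" if "finite_feasible s" for s
    using that by (intro sum_nonneg Dh_nonneg) (auto simp: finite_feasible_def)
  have descent: "A (Suc k) + H (Suc k) + F k \<le> A k" for k
  proof -
    let ?g = "\<lambda>s. ennreal (energy s + (\<Sum>i\<in>V. Dh s i))"
    have "A (Suc k) + H (Suc k) = (\<integral>\<^sup>+ s. ennreal (energy s) + ennreal (\<Sum>i\<in>V. Dh s i) \<partial>measure_pmf (P (Suc k)))"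
      unfolding A_def H_def by (rule nn_integral_add[symmetric]) auto
    also have "\<dots> = (\<integral>\<^sup>+ s. ?g s \<partial>measure_pmf (P (Suc k)))"
      by (rule nn_integral_cong_AE, rule AE_pmfI) (simp add: energy_nonneg Dh0[OF fin])
    also have "\<dots> = (\<integral>\<^sup>+ s. (\<integral>\<^sup>+ J. ?g (iterate J s) \<partial>measure_pmf (sampling V n)) \<partial>measure_pmf (P k))"
      unfolding P_def skpd_law_Suc iterate_def by simp
    finally have "A (Suc k) + H (Suc k) + F k
      = (\<integral>\<^sup>+ s. (\<integral>\<^sup>+ J. ?g (iterate J s) \<partial>measure_pmf (sampling V n)) + ennreal (\<Sum>i\<in>V. Df s i) \<partial>measure_pmf (P k))"
      unfolding F_def by (simp add: nn_integral_add)
    also have "\<dots> \<le> A k"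
      unfolding A_def
      by (rule nn_integral_mono_AE, rule AE_pmfI, rule sampled_energy_le)
        (use fin in \<open>simp add: finite_feasible_def\<close>)
    finally show ?thesis .
  qed
  have "A T + (\<Sum>k<T. F k + H (Suc k)) \<le> A 0"
  proof (induction T)
    case (Suc T)
    have "A (Suc T) + (\<Sum>k<Suc T. F k + H (Suc k)) = (A (Suc T) + H (Suc T) + F T) + (\<Sum>k<T. F k + H (Suc k))"
      by (simp add: ac_simps)
    also have "\<dots> \<le> A T + (\<Sum>k<T. F k + H (Suc k))" by (rule add_right_mono[OF descent])
    finally show ?case using Suc by (rule order_trans)
  qed simp
  then have tele: "(\<Sum>k<T. F k + H (Suc k)) \<le> A 0"
    by (rule order_trans[rotated]) (simp add: add_increasing)
  have "(\<Sum>t\<in>{1..T}. expected_bregman V n f h xs vs (skpd_law V E n \<rho> \<eta> f h s1 t)) = (\<Sum>k<T. F k + H k)"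
    by (simp add: sum.atLeast1_atMost_eq split)
  also have "\<dots> = (\<Sum>k<T. F k) + (\<Sum>k<T. H k)" by (rule sum.distrib)
  \<comment> \<open>Index alignment: appending the nonnegative \<open>H T\<close> and splitting off
    \<open>H 0\<close> turns the sum of \<open>H k\<close> into that of
    \<open>H (Suc k)\<close>.\<close>
  also have "\<dots> \<le> (\<Sum>k<T. F k) + (\<Sum>k<Suc T. H k)" by (intro add_left_mono sum_mono2) auto
  also have "(\<Sum>k<Suc T. H k) = H 0 + (\<Sum>k<T. H (Suc k))" by (rule sum.lessThan_Suc_shift)
  also have "(\<Sum>k<T. F k) + (H 0 + (\<Sum>k<T. H (Suc k))) = (\<Sum>k<T. F k + H (Suc k)) + H 0"
    by (simp add: sum.distrib ac_simps)
  also have "\<dots> \<le> A 0 + H 0" by (rule add_right_mono[OF tele])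
  also have "\<dots> = ennreal (energy s1 + (\<Sum>i\<in>V. Dh s1 i))"
    using energy_nonneg Dh0[OF s1] by (simp add: A_def H_def P_def skpd_law_def)
  finally show ?thesis .
qed

text \<open>The lower bound on \<open>L\<close> is \<open>L\<^sup>2 \<ge> 1/32\<close>; it absorbs the term \<open>n W\<^sub>2 / (8 L)\<close> of the memory
  into \<open>4 n L W\<^sub>2\<close>.\<close>

lemma initial_energy_le:
  assumes L: "L \<ge> 1 / (4 * sqrt 2)" and fin: "finite_feasible s"
    and x: "\<And>i. i \<in> V \<Longrightarrow> (norm (primal s i - xs i))\<^sup>2 \<le> W\<^sub>1"
    and l: "\<And>i j. i \<in> V \<Longrightarrow> j \<in> nbrs E i \<Longrightarrow> (norm (dual s i j - ls i j))\<^sup>2 \<le> W\<^sub>1"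
    and D: "\<And>i. i \<in> V \<Longrightarrow> Df s i + Dh s i \<le> W\<^sub>1"
    and m: "\<And>i. i \<in> V \<Longrightarrow> (norm (memory s i - gs i))\<^sup>2 \<le> W\<^sub>2"
  shows "energy s + (\<Sum>i\<in>V. Dh s i)
    \<le> (8 + \<rho> + 1 / \<rho>) * (\<bar>W\<^sub>1\<bar> + \<bar>W\<^sub>2\<bar>) * (real (card E) + real (card V) * (1 + real n * L))"
proof -
  define W where "W = \<bar>W\<^sub>1\<bar> + \<bar>W\<^sub>2\<bar>"
  have W: "W \<ge> 0" "W\<^sub>1 \<le> W" "W\<^sub>2 \<le> W" by (auto simp: W_def)
  have "1 / 32 = (1 / (4 * sqrt 2))\<^sup>2" by (simp add: power_divide power_mult_distrib)
  also have "\<dots> \<le> L\<^sup>2" using L by (intro power_mono) auto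
  finally have "real n / (8 * L) \<le> 4 * real n * L"
    using L_pos n_pos by (simp add: field_simps power2_eq_square)
  have "4 * real n * L * (norm (primal s i - xs i))\<^sup>2 + real n / (8 * L) * (norm (memory s i - gs i))\<^sup>2
      + Dh s i \<le> 8 * W * (1 + real n * L)" if i: "i \<in> V" for i
  proof -
    have "4 * real n * L * (norm (primal s i - xs i))\<^sup>2 \<le> 4 * real n * L * W"
      using x[OF i] W L_pos by (intro mult_left_mono) auto
    moreover have "real n / (8 * L) * (norm (memory s i - gs i))\<^sup>2 \<le> 4 * real n * L * W"
      using m[OF i] W L_pos \<open>real n / (8 * L) \<le> 4 * real n * L\<close> by (intro mult_mono) auto
    moreover have "Dh s i \<le> 8 * W"
      using D[OF i] Df_nonneg[OF _ i, of s] fin W by (auto simp: finite_feasible_def)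
    ultimately show ?thesis by (simp add: algebra_simps)
  qed
  then have "(\<Sum>i\<in>V. 4 * real n * L * (norm (primal s i - xs i))\<^sup>2
      + real n / (8 * L) * (norm (memory s i - gs i))\<^sup>2 + Dh s i) \<le> (\<Sum>i\<in>V. 8 * W * (1 + real n * L))"
    by (rule sum_mono)
  then have nodes: "(\<Sum>i\<in>V. 4 * real n * L * (norm (primal s i - xs i))\<^sup>2
      + real n / (8 * L) * (norm (memory s i - gs i))\<^sup>2) + (\<Sum>i\<in>V. Dh s i) \<le> real (card V) * (8 * W * (1 + real n * L))"
    by (simp add: sum.distrib)
  have edge: "(norm (dual s i j - ls i j - \<rho> *\<^sub>R (primal s i - xs i)))\<^sup>2 \<le> 2 * (1 + \<rho>\<^sup>2) * W"
    if i: "i \<in> V" and j: "j \<in> nbrs E i" for i j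
  proof -
    let ?a = "dual s i j - ls i j" and ?X = "primal s i - xs i"
    \<comment> \<open>Nonnegativity of the square with the opposite sign bounds the cross term by
      the two squares.\<close>
    have "0 \<le> (norm (?a - (- \<rho>) *\<^sub>R ?X))\<^sup>2" by simp
    then have "(norm (?a - \<rho> *\<^sub>R ?X))\<^sup>2 \<le> 2 * (norm ?a)\<^sup>2 + 2 * (\<rho>\<^sup>2 * (norm ?X)\<^sup>2)"
      unfolding power2_norm_diff_scaleR by simp
    also have "\<dots> \<le> 2 * W + 2 * (\<rho>\<^sup>2 * W)"
      using x[OF i] l[OF i j] W by (intro add_mono mult_left_mono) auto
    finally show ?thesis by (simp add: algebra_simps)
  qed
  have "edge_energy s \<le> 1 / (4 * \<rho>) * (\<Sum>i\<in>V. \<Sum>j\<in>nbrs E i. 2 * (1 + \<rho>\<^sup>2) * W)"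
    unfolding edge_energy_def using \<rho>_pos edge by (intro mult_left_mono sum_mono) auto
  also have "\<dots> = 1 / (4 * \<rho>) * (real (\<Sum>i\<in>V. card (nbrs E i)) * (2 * (1 + \<rho>\<^sup>2) * W))"
    by (simp add: sum_distrib_right)
  also have "\<dots> \<le> 1 / (4 * \<rho>) * (real (2 * card E) * (2 * (1 + \<rho>\<^sup>2) * W))"
    using \<rho>_pos W sum_card_nbrs_le[OF graph]
    by (intro mult_left_mono mult_right_mono) (auto simp del: of_nat_sum of_nat_mult)
  \<comment> \<open>The constant is \<open>4 * (1 + \<rho>\<^sup>2) / (4 * \<rho>)\<close>: a factor
    2 from the orientations of an edge and a factor 2 from splitting the square.\<close>
  also have "\<dots> = (\<rho> + 1 / \<rho>) * W * real (card E)"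
    using \<rho>_pos by (simp add: field_simps power2_eq_square)
  finally have "energy s + (\<Sum>i\<in>V. Dh s i)
    \<le> real (card V) * (8 * W * (1 + real n * L)) + (\<rho> + 1 / \<rho>) * W * real (card E)"
    using nodes unfolding energy_def by linarith
  also have "\<dots> \<le> (8 + \<rho> + 1 / \<rho>) * W * (real (card V) * (1 + real n * L))
      + (8 + \<rho> + 1 / \<rho>) * W * real (card E)"
  proof (rule add_mono)
    have "8 * W \<le> (8 + \<rho> + 1 / \<rho>) * W"
      using W \<rho>_pos by (intro mult_right_mono) auto
    then have "8 * W * (real (card V) * (1 + real n * L))
      \<le> (8 + \<rho> + 1 / \<rho>) * W * (real (card V) * (1 + real n * L))"
      by (rule mult_right_mono) (use L_pos in simp)
    then show "real (card V) * (8 * W * (1 + real n * L))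
      \<le> (8 + \<rho> + 1 / \<rho>) * W * (real (card V) * (1 + real n * L))"
      by (simp only: mult.left_commute[of "8 * W"])
    have "(\<rho> + 1 / \<rho>) * W \<le> (8 + \<rho> + 1 / \<rho>) * W"
      using W \<rho>_pos by (intro mult_mono) auto
    then show "(\<rho> + 1 / \<rho>) * W * real (card E) \<le> (8 + \<rho> + 1 / \<rho>) * W * real (card E)"
      by (rule mult_right_mono) simp
  qed
  also have "\<dots> = (8 + \<rho> + 1 / \<rho>) * W * (real (card E) + real (card V) * (1 + real n * L))"
    by (simp only: distrib_left add.commute)
  finally show ?thesis by (simp add: W_def)
qed

end

subsection \<open>Oracle complexity\<close>

text \<open>The minimum is at most the average, so \<open>T\<close> of about
  \<open>R / \<epsilon>\<close> suffices. Rounding up at most doubles a number above 1, and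
  otherwise one call is enough.\<close>

lemma oracle_complexity_le:
  assumes sum: "\<And>T. (\<Sum>t\<in>{1..T}. \<Delta> t) \<le> ennreal R" and "\<epsilon> > 0" "R \<ge> 0"
  shows "ereal_of_enat (oracle_complexity \<Delta> \<epsilon>) \<le> ereal (max 1 (2 * R / \<epsilon>))"
proof -
  define T where "T = max 1 (nat \<lceil>R / \<epsilon>\<rceil>)"
  have T: "T \<ge> 1" by (simp add: T_def)
  have "R / \<epsilon> \<le> real (nat \<lceil>R / \<epsilon>\<rceil>)" by (rule real_nat_ceiling_ge)
  also have "\<dots> \<le> real T" by (simp add: T_def)
  finally have RT: "R \<le> real T * \<epsilon>" using \<open>\<epsilon> > 0\<close> by (simp add: field_simps)
  have "of_nat T * (MIN t\<in>{1..T}. \<Delta> t) \<le> (\<Sum>t\<in>{1..T}. \<Delta> t)"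
    using sum_bounded_below[of "{1..T}" "MIN t\<in>{1..T}. \<Delta> t" \<Delta>] by simp
  also have "\<dots> \<le> ennreal R" by (rule sum)
  also have "\<dots> \<le> ennreal (real T * \<epsilon>)" using RT by (rule ennreal_leI)
  also have "\<dots> = of_nat T * ennreal \<epsilon>" using \<open>\<epsilon> > 0\<close> by (simp add: ennreal_mult ennreal_of_nat_eq_real_of_nat)
  finally have "(MIN t\<in>{1..T}. \<Delta> t) \<le> ennreal \<epsilon>"
    using T by (subst (asm) ennreal_mult_le_mult_iff) auto
  then have "oracle_complexity \<Delta> \<epsilon> \<le> enat T"
    unfolding oracle_complexity_def using T by (intro Inf_lower) auto
  then have "ereal_of_enat (oracle_complexity \<Delta> \<epsilon>) \<le> ereal (real T)"
    by (metis ereal_of_enat_le_iff ereal_of_enat_simps(1))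
  also have "real T \<le> max 1 (2 * R / \<epsilon>)"
  proof (cases "R / \<epsilon> \<le> 1")
    case True
    then have "nat \<lceil>R / \<epsilon>\<rceil> \<le> 1" by (simp add: ceiling_le_iff nat_le_iff)
    then show ?thesis by (simp add: T_def)
  next
    case False
    then have "real (nat \<lceil>R / \<epsilon>\<rceil>) \<le> 2 * (R / \<epsilon>)" by linarith
    then show ?thesis by (auto simp: T_def max_def)
  qed
  finally show ?thesis by simp
qed

text \<open>The constant is chosen after \<rho>, \<open>W\<^sub>1\<close> and
  \<open>W\<^sub>2\<close> only, hence uniform in network, dimension, smoothness and accuracy.
  \<open>W\<^sub>2\<close> measures the initial memory error, an initialization-dependent quantity;
  \<open>max 1\<close> reflects that a complexity is at least one call.\<close>

theorem lemmaC1: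
  fixes \<rho> W\<^sub>1 W\<^sub>2 :: real
  assumes "\<rho> > 0"
  shows "\<exists>C>0. \<forall>(V :: 'v set) (E :: 'v set set) (n :: nat) (L :: real) (K :: 'v \<Rightarrow> nat)
      (F :: 'v \<Rightarrow> nat \<Rightarrow> rvec \<Rightarrow> real) (h :: 'v \<Rightarrow> rvec \<Rightarrow> ereal) (\<eta> :: 'v \<Rightarrow> real)
      (xs :: 'v \<Rightarrow> rvec) (ls :: 'v \<Rightarrow> 'v \<Rightarrow> rvec) (vs :: 'v \<Rightarrow> rvec)
      (s1 :: 'v skpd_state) (\<epsilon> :: real).
    (let f = avg K F;
         \<Delta> = (\<lambda>t. expected_bregman V n f h xs vs (skpd_law V E n \<rho> \<eta> f h s1 t))
     in
       connected_graph V E \<and> n \<ge> 1 \<and> L \<ge> 1 / (4 * sqrt 2) \<and>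
       (\<forall>i\<in>V. K i \<ge> 1) \<and>
       (\<forall>i\<in>V. \<forall>k\<in>{1..K i}. proper_closed_convex n (\<lambda>x. ereal (F i k x)) \<and> L_smooth n L (F i k)) \<and>
       (\<forall>i\<in>V. proper_closed_convex n (h i)) \<and>
       consensus_solution V E n f h xs \<and>
       kkt_point V E n f h xs ls vs \<and>
       (\<forall>i\<in>V. \<eta> i = 1 / (8 * real n * L)) \<and>
       (\<forall>i\<in>V. primal s1 i \<in> Rn n \<and> memory s1 i = 0) \<and>
       (\<forall>i\<in>V. \<forall>j\<in>nbrs E i. dual s1 i j \<in> Rn n) \<and>
       (\<forall>i\<in>V. (norm (primal s1 i - xs i))\<^sup>2 \<le> W\<^sub>1) \<and>
       (\<forall>i\<in>V. \<forall>j\<in>nbrs E i. (norm (dual s1 i j - ls i j))\<^sup>2 \<le> W\<^sub>1) \<and>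
       (\<forall>i\<in>V. bregman n (f i) (h i) (vs i) (primal s1 i) (xs i) \<le> ereal W\<^sub>1) \<and>
       (\<forall>i\<in>V. (norm (memory s1 i - grad n (f i) (xs i)))\<^sup>2 \<le> W\<^sub>2) \<and>
       \<epsilon> > 0
       \<longrightarrow> ereal_of_enat (oracle_complexity \<Delta> \<epsilon>)
             \<le> ereal (max 1 (C * ((real (card E) + real (card V) * (1 + real n * L)) / \<epsilon>))))"
proof -
  define c where "c = (8 + \<rho> + 1 / \<rho>) * (\<bar>W\<^sub>1\<bar> + \<bar>W\<^sub>2\<bar>)"
  have c: "c \<ge> 0" using assms by (simp add: c_def)
  \<comment> \<open>The factor 2 stems from rounding up in \<open>oracle_complexity_le\<close>;
    adding 1 keeps the witness positive when \<open>c = 0\<close>.\<close>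
  show ?thesis
  proof (rule exI[of _ "2 * c + 1"], unfold Let_def, intro conjI allI impI, goal_cases)
    case 1
    show ?case using c by simp
  next
    case (2 V E n L K F h \<eta> xs ls vs s1 \<epsilon>)
    let ?f = "avg K F"
    have conn: "connected_graph V E" and n: "n \<ge> 1" and L: "L \<ge> 1 / (4 * sqrt 2)"
      and K: "\<And>i. i \<in> V \<Longrightarrow> K i \<ge> 1"
      and F: "\<And>i k. i \<in> V \<Longrightarrow> k \<in> {1..K i} \<Longrightarrow> proper_closed_convex n (\<lambda>x. ereal (F i k x)) \<and> L_smooth n L (F i k)"
      and pcc: "\<And>i. i \<in> V \<Longrightarrow> proper_closed_convex n (h i)"
      and kkt: "kkt_point V E n ?f h xs ls vs"
      and \<eta>: "\<And>i. i \<in> V \<Longrightarrow> \<eta> i = 1 / (8 * real n * L)"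
      and s1: "\<And>i. i \<in> V \<Longrightarrow> primal s1 i \<in> Rn n" "\<And>i. i \<in> V \<Longrightarrow> memory s1 i = 0"
        "\<And>i j. i \<in> V \<Longrightarrow> j \<in> nbrs E i \<Longrightarrow> dual s1 i j \<in> Rn n"
      and W1: "\<And>i. i \<in> V \<Longrightarrow> (norm (primal s1 i - xs i))\<^sup>2 \<le> W\<^sub>1"
        "\<And>i j. i \<in> V \<Longrightarrow> j \<in> nbrs E i \<Longrightarrow> (norm (dual s1 i j - ls i j))\<^sup>2 \<le> W\<^sub>1"
      and D1: "\<And>i. i \<in> V \<Longrightarrow> bregman n (?f i) (h i) (vs i) (primal s1 i) (xs i) \<le> ereal W\<^sub>1"
      and W2: "\<And>i. i \<in> V \<Longrightarrow> (norm (memory s1 i - grad n (?f i) (xs i)))\<^sup>2 \<le> W\<^sub>2"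
      and \<epsilon>: "\<epsilon> > 0"
      using 2 by blast+
    have "0 < 1 / (4 * sqrt 2)" by simp
    then have L_pos: "L > 0" using L by linarith
    interpret skpd_problem V E n L \<rho> ?f h \<eta> xs ls vs
    proof unfold_locales
      show "L_smooth n L (?f i)" if "i \<in> V" for i
        by (rule L_smooth_avg[of K]) (use K F that in auto)
      show "convex_on (Rn n) (?f i)" if "i \<in> V" for i
        by (rule convex_on_avg, rule convex_on_epi) (use F that in \<open>auto simp: proper_closed_convex_def\<close>)
    qed (fact assms n L_pos conn pcc kkt \<eta>)+
    \<comment> \<open>The real bound \<open>W\<^sub>1\<close> on the initial divergence excludes an
      infinite value of \<open>h i\<close> at the starting point.\<close>
    have h_fin: "\<bar>h i (primal s1 i)\<bar> \<noteq> \<infinity>" if i: "i \<in> V" for i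
    proof -
      have "h i (primal s1 i) \<noteq> -\<infinity>"
        using pcc[OF i] s1(1)[OF i] by (simp add: proper_closed_convex_def proper_def)
      moreover have "\<bar>h i (xs i)\<bar> \<noteq> \<infinity>"
        by (rule subgradient_imp_finite[OF pcc xs_Rn vs_sub]) (rule i)+
      then have "h i (primal s1 i) \<noteq> \<infinity>"
        using D1[OF i] by (auto simp: bregman_def bregman_subgrad_def)
      ultimately show ?thesis by auto
    qed
    have fin: "finite_feasible s1"
      unfolding finite_feasible_def feasible_def
      using s1 h_fin subspace_0[OF subspace_Rn] by simp
    let ?S = "real (card E) + real (card V) * (1 + real n * L)"
    have "energy s1 + (\<Sum>i\<in>V. Dh s1 i) \<le> c * ?S"
      unfolding c_def
    proof (rule initial_energy_le[OF L fin W1])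
      show "Df s1 i + Dh s1 i \<le> W\<^sub>1" if "i \<in> V" for i
        using D1[OF that] by (simp add: bregman_def bregman_subgrad_eq_Dh(1)[OF that h_fin[OF that]] Df_def)
      show "(norm (memory s1 i - gs i))\<^sup>2 \<le> W\<^sub>2" if "i \<in> V" for i
        using W2[OF that] by (simp add: gs_def)
    qed
    then have "(\<Sum>t\<in>{1..T}. expected_bregman V n ?f h xs vs (skpd_law V E n \<rho> \<eta> ?f h s1 t)) \<le> ennreal (c * ?S)" for T
      by (rule order_trans[OF sum_expected_bregman_le[OF fin] ennreal_leI])
    moreover have S: "0 \<le> ?S" using L_pos by simp
    ultimately have "ereal_of_enat (oracle_complexity (\<lambda>t. expected_bregman V n ?f h xs vs (skpd_law V E n \<rho> \<eta> ?f h s1 t)) \<epsilon>)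
      \<le> ereal (max 1 (2 * (c * ?S) / \<epsilon>))"
      using c \<epsilon> by (intro oracle_complexity_le) auto
    also have "2 * c * (?S / \<epsilon>) \<le> (2 * c + 1) * (?S / \<epsilon>)"
      using divide_nonneg_pos[OF S \<epsilon>] by (intro mult_right_mono) auto
    then have "2 * (c * ?S) / \<epsilon> \<le> (2 * c + 1) * (?S / \<epsilon>)"
      by (simp only: times_divide_eq_right mult.assoc)
    then have "ereal (max 1 (2 * (c * ?S) / \<epsilon>)) \<le> ereal (max 1 ((2 * c + 1) * (?S / \<epsilon>)))"
      unfolding ereal_less_eq by (rule max.mono[OF order_refl])
    finally show ?case .
  qed
qed

end
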